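(* Let $F$ be a known non-degenerate distribution function on $\mathbb{R}$ with finite second moment, and assume $F$ belongs to the class NCP (defined in the context). Let $\omega=\omega(F)=\inf\{x\in\mathbb{R}:F(x)=1\}$ (with $\omega=+\infty$ if $F(x)<1$ for all $x$). Suppose that $\lim_{x\to\omega-}F(x)=1$ and that $F$ is differentiable on a left neighborhood $(M,\omega)$ of $\omega$, with derivative $f(x)=F'(x)$ for $x\in(M,\omega)$. For $\delta\in\mathbb{R}$, $\gamma\in\mathbb{R}$ define \[ L(x;\delta,\gamma;F)=\frac{f(x)}{(1-F(x))^{\gamma}(-\log(1-F(x)))^{\delta}},\qquad x\in(M,\omega), \] and $L_*(\delta,\gamma;F)=\liminf_{x\to\omega-}L(x;\delta,\gamma;F)$, $L^*(\delta,\gamma;F)=\limsup_{x\to\omega-}L(x;\delta,\gamma;F)$. If either (i) for some $\gamma<3/2$ and $\delta=0$, or (ii) for some $\delta>0$ and some $\gamma$ with $1/2<\gamma\le 1$, we have \[ 0<L_*(\delta,\gamma;F)\le L^*(\delta,\gamma;F)<+\infty, \] then the partial maxima BLUE $L_2^{(n)}$ of the scale parameter $\theta_2$ is consistent (i.e. $L_2^{(n)}\to\theta_2$ in probability as $n\to\infty$, for all $\theta_1\in\mathbb{R}$, $\theta_2>0$) and, moreover, $\operatorname{Var}[L_2^{(n)}]=O(1/\log n)$ as $n\to\infty$.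
   Context: Setting: $F$ is a known, parameter-free, non-degenerate distribution function on $\mathbb{R}$ with finite second moment. For unknown $\theta_1\in\mathbb{R}$ and $\theta_2>0$, let $X_1^*,\dots,X_n^*$ be i.i.d. with distribution function $F((x-\theta_1)/\theta_2)$, and let $X^*_{j:j}=\max\{X_1^*,\dots,X_j^*\}$, $j=1,\dots,n$ (the partial maxima). A linear estimator is $\sum_{i=1}^n c_iX^*_{i:i}$ with constants $c_i$ (depending on $n$ and $F$ only). The partial maxima BLUE $L_2^{(n)}$ of $\theta_2$ is the linear estimator which is unbiased for $\theta_2$ for all $(\theta_1,\theta_2)$ and has minimum variance among all such estimators. Let $X_1,X_2,\dots$ be i.i.d. with distribution function $F$, $X_{j:j}=\max\{X_1,\dots,X_j\}$, and define the partial maxima spacings $Z_i=X_{i+1:i+1}-X_{i:i}$, $i\ge1$. $F$ (with finite second moment) belongs to the class NCP if $\operatorname{Cov}[Z_i,Z_j]\le 0$ for all positive integers $i\neq j$. *)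

theory Defs
  imports "HOL-Probability.Probability" "HOL-Library.Landau_Symbols"
begin

text \<open>Canonical i.i.d. model: coordinates of the infinite product of the law D
  (distribution function F = cdf D).  X_k(w) = w k, k = 1,2,...\<close>
definition iid_model :: "real measure \<Rightarrow> (nat \<Rightarrow> real) measure" where
  "iid_model D = PiM UNIV (\<lambda>_. D)"

definition pmax :: "(nat \<Rightarrow> real) \<Rightarrow> nat \<Rightarrow> real" where
  "pmax w j = Max (w ` {1..j})"

text \<open>Linear estimator sum_{i=1}^n c_i X*_{i:i}, with X*_k = t1 + t2 X_k
  (so X*_k has distribution function F((x - t1)/t2)).\<close>
definition lin_est :: "(nat \<Rightarrow> real) \<Rightarrow> nat \<Rightarrow> real \<Rightarrow> real \<Rightarrow> (nat \<Rightarrow> real) \<Rightarrow> real" where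
  "lin_est c n t1 t2 w = (\<Sum>i=1..n. c i * pmax (\<lambda>k. t1 + t2 * w k) i)"

definition variance_of :: "'a measure \<Rightarrow> ('a \<Rightarrow> real) \<Rightarrow> real" where
  "variance_of P X = (\<integral>w. (X w - (\<integral>v. X v \<partial>P))\<^sup>2 \<partial>P)"

definition covariance_of :: "'a measure \<Rightarrow> ('a \<Rightarrow> real) \<Rightarrow> ('a \<Rightarrow> real) \<Rightarrow> real" where
  "covariance_of P X Y = (\<integral>w. (X w - (\<integral>v. X v \<partial>P)) * (Y w - (\<integral>v. Y v \<partial>P)) \<partial>P)"

definition unbiased_scale :: "real measure \<Rightarrow> nat \<Rightarrow> (nat \<Rightarrow> real) \<Rightarrow> bool" where
  "unbiased_scale D n c \<longleftrightarrow>
     (\<forall>t1 t2. t2 > 0 \<longrightarrow> integrable (iid_model D) (lin_est c n t1 t2) \<and>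
        (\<integral>w. lin_est c n t1 t2 w \<partial>iid_model D) = t2)"

definition is_BLUE_scale :: "real measure \<Rightarrow> nat \<Rightarrow> (nat \<Rightarrow> real) \<Rightarrow> bool" where
  "is_BLUE_scale D n c \<longleftrightarrow> unbiased_scale D n c \<and>
     (\<forall>d. unbiased_scale D n d \<longrightarrow>
        (\<forall>t1 t2. t2 > 0 \<longrightarrow>
           variance_of (iid_model D) (lin_est c n t1 t2)
             \<le> variance_of (iid_model D) (lin_est d n t1 t2)))"

definition spacing :: "nat \<Rightarrow> (nat \<Rightarrow> real) \<Rightarrow> real" where
  "spacing i w = pmax w (i + 1) - pmax w i"

definition NCP :: "real measure \<Rightarrow> bool" where
  "NCP D \<longleftrightarrow> integrable D (\<lambda>x. x\<^sup>2) \<and>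
     (\<forall>i j. 1 \<le> i \<longrightarrow> 1 \<le> j \<longrightarrow> i \<noteq> j \<longrightarrow>
        covariance_of (iid_model D) (spacing i) (spacing j) \<le> 0)"

definition nondegenerate :: "(real \<Rightarrow> real) \<Rightarrow> bool" where
  "nondegenerate F \<longleftrightarrow> \<not> (\<exists>c. \<forall>x. F x = (if c \<le> x then 1 else 0))"

text \<open>omega(F) = inf {x. F x = 1}, equal to +infinity if the set is empty.\<close>
definition omega :: "(real \<Rightarrow> real) \<Rightarrow> ereal" where
  "omega F = Inf (ereal ` {x. F x = 1})"

definition to_omega :: "(real \<Rightarrow> real) \<Rightarrow> real filter" where
  "to_omega F = (if omega F = \<infinity> then at_top else at_left (real_of_ereal (omega F)))"

definition Lfun :: "(real \<Rightarrow> real) \<Rightarrow> (real \<Rightarrow> real) \<Rightarrow> real \<Rightarrow> real \<Rightarrow> real \<Rightarrow> real" where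
  "Lfun F f \<delta> \<gamma> x = f x / ((1 - F x) powr \<gamma> * (- ln (1 - F x)) powr \<delta>)"

definition L_lower :: "(real \<Rightarrow> real) \<Rightarrow> (real \<Rightarrow> real) \<Rightarrow> real \<Rightarrow> real \<Rightarrow> ereal" where
  "L_lower F f \<delta> \<gamma> = Liminf (to_omega F) (\<lambda>x. ereal (Lfun F f \<delta> \<gamma> x))"

definition L_upper :: "(real \<Rightarrow> real) \<Rightarrow> (real \<Rightarrow> real) \<Rightarrow> real \<Rightarrow> real \<Rightarrow> ereal" where
  "L_upper F f \<delta> \<gamma> = Limsup (to_omega F) (\<lambda>x. ereal (Lfun F f \<delta> \<gamma> x))"

end

theory Submission
  imports Defs "HOL-Real_Asymp.Real_Asymp"
begin

text \<open>
  Since the spacings \<open>Z\<^sub>i\<close> are nonpositively correlated, any unbiased combination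
  \<open>\<Sum>i. e\<^sub>i Z\<^sub>i\<close> with nonnegative weights has variance at most \<open>\<Sum>i. e\<^sub>i\<^sup>2 E[Z\<^sub>i\<^sup>2]\<close>. If
  \<open>E[Z\<^sub>k\<^sup>2] \<le> C k (E[Z\<^sub>k])\<^sup>2\<close> for all \<open>k\<close>, then the weights proportional to \<open>1 / (i E[Z\<^sub>i])\<close> bring this
  bound down to \<open>C\<close> divided by a harmonic number, and the BLUE can only do better.

  The moment inequality comes from Tonelli: with \<open>G = 1 - F\<close>,
  \<open>E[Z\<^sub>k] = \<integral> F\<^sup>k G\<close> and \<open>E[Z\<^sub>k\<^sup>2] = 2 \<integral> F(x)\<^sup>k (\<integral>\<^bsub>y \<ge> x\<^esub> G(y) dy) dx\<close>. When the density \<open>f\<close> is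
  comparable to \<open>G\<^sup>\<gamma> (- log G)\<^sup>\<delta>\<close> near the right endpoint, with \<open>\<gamma> < 3/2\<close> and \<open>\<delta> \<ge> 0\<close> (this covers both
  cases (i) and (ii)), the first integral is at least of order \<open>k\<^bsup>\<gamma>-2\<^esup> (log k)\<^bsup>-\<delta>\<^esup>\<close>, which is seen
  between the quantiles \<open>1 - 2/k\<close> and \<open>1 - 1/k\<close>, and the second is at most of order
  \<open>k\<^bsup>2\<gamma>-3\<^esup> (log k)\<^bsup>-2\<delta>\<^esup>\<close>: to the left of the quantile \<open>1 - 1/\<surd>k\<close> the factor \<open>F\<^sup>k\<close> is negligible,
  and to its right \<open>- log G\<close> is at least \<open>(log k)/2\<close>.
\<close>

section \<open>Moments of the spacings\<close>

lemma nn_integral_le_antiderivative: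
  fixes p q q' :: "real \<Rightarrow> real"
  assumes "a \<le> b"
    and der: "\<And>x. a \<le> x \<Longrightarrow> x \<le> b \<Longrightarrow> (q has_real_derivative q' x) (at x)"
    and le: "\<And>x. a \<le> x \<Longrightarrow> x \<le> b \<Longrightarrow> p x \<le> q' x"
    and nonneg: "\<And>x. a \<le> x \<Longrightarrow> x \<le> b \<Longrightarrow> 0 \<le> q' x"
  shows "(\<integral>\<^sup>+x. ennreal (p x) * indicator {a..b} x \<partial>lborel) \<le> ennreal (q b - q a)"
proof -
  have "(q' has_integral q b - q a) {a..b}"
    using \<open>a \<le> b\<close> der
    by (intro fundamental_theorem_of_calculus)
       (auto simp: has_real_derivative_iff_has_vector_derivative [symmetric]
             intro: has_field_derivative_at_within)
  then have "(\<integral>\<^sup>+x. ennreal (q' x) * indicator {a..b} x \<partial>lborel) = ennreal (q b - q a)"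
    using nonneg by (intro nn_integral_has_integral_lebesgue') auto
  moreover have "(\<integral>\<^sup>+x. ennreal (p x) * indicator {a..b} x \<partial>lborel)
      \<le> (\<integral>\<^sup>+x. ennreal (q' x) * indicator {a..b} x \<partial>lborel)"
    using le by (intro nn_integral_mono) (auto simp: indicator_def intro: ennreal_leI)
  ultimately show ?thesis by simp
qed

text \<open>Exhausting the interval from \<open>a\<close> to \<open>\<omega>\<close> by compact
  intervals reduces the bound to the previous one, and monotone convergence passes to the limit. A
  finite and an infinite right endpoint are treated alike, and only a bound on the increments of
  \<open>q\<close> is asked for, not a limit at \<open>\<omega>\<close>.\<close>

lemma nn_integral_le_antiderivative_up_to:
  fixes p q q' :: "real \<Rightarrow> real" and \<omega> :: ereal
  assumes [measurable]: "p \<in> borel_measurable borel"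
    and "ereal a < \<omega>"
    and der: "\<And>x. a \<le> x \<Longrightarrow> ereal x < \<omega> \<Longrightarrow> (q has_real_derivative q' x) (at x)"
    and le: "\<And>x. a \<le> x \<Longrightarrow> ereal x < \<omega> \<Longrightarrow> p x \<le> q' x"
    and nonneg: "\<And>x. a \<le> x \<Longrightarrow> ereal x < \<omega> \<Longrightarrow> 0 \<le> q' x"
    and upper: "\<And>x. a \<le> x \<Longrightarrow> ereal x < \<omega> \<Longrightarrow> q x - q a \<le> K"
  shows "(\<integral>\<^sup>+x. ennreal (p x) * indicator {x. a \<le> x \<and> ereal x < \<omega>} x \<partial>lborel) \<le> ennreal K"
proof -
  obtain B :: "nat \<Rightarrow> real"
    where B: "incseq B" "\<And>i. ereal a < B i" "\<And>i. B i < \<omega>" "B \<longlonglongrightarrow> \<omega>"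
    using ereal_incseq_approx [OF \<open>ereal a < \<omega>\<close>] by metis
  have sup: "(SUP i. ennreal (p x) * indicator {a..B i} x)
      = ennreal (p x) * indicator {x. a \<le> x \<and> ereal x < \<omega>} x" for x
  proof (cases "a \<le> x \<and> ereal x < \<omega>")
    case True
    then have "eventually (\<lambda>i. ereal x < B i) sequentially"
      using order_tendstoD(1) [OF B(4)] by blast
    then obtain i where i: "x \<le> B i"
      by (auto simp: eventually_sequentially dest: less_imp_le)
    show ?thesis
    proof (rule antisym)
      show "(SUP i. ennreal (p x) * indicator {a..B i} x)
          \<le> ennreal (p x) * indicator {x. a \<le> x \<and> ereal x < \<omega>} x"
        using True by (intro SUP_least) (auto simp: indicator_def)
      show "ennreal (p x) * indicator {x. a \<le> x \<and> ereal x < \<omega>} x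
          \<le> (SUP i. ennreal (p x) * indicator {a..B i} x)"
        using True i by (intro SUP_upper2 [of i]) (auto simp: indicator_def)
    qed
  next
    case False
    then have "x \<notin> {a..B i}" for i
      using B(3) [of i] order.strict_trans1 [of "ereal x" "ereal (B i)" \<omega>] by auto
    with False show ?thesis by simp
  qed
  have "(\<integral>\<^sup>+x. ennreal (p x) * indicator {x. a \<le> x \<and> ereal x < \<omega>} x \<partial>lborel)
      = (\<integral>\<^sup>+x. (SUP i. ennreal (p x) * indicator {a..B i} x) \<partial>lborel)"
    by (simp only: sup)
  also have "\<dots> = (SUP i. \<integral>\<^sup>+x. ennreal (p x) * indicator {a..B i} x \<partial>lborel)"
  proof (rule nn_integral_monotone_convergence_SUP)
    show "incseq (\<lambda>i x. ennreal (p x) * indicator {a..B i} x)"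
      using incseq_SucD [OF B(1)]
      by (intro incseq_SucI le_funI mult_left_mono) (auto simp: indicator_def intro: order_trans)
  qed measurable
  also have "\<dots> \<le> ennreal K"
  proof (rule SUP_least)
    fix i
    have *: "ereal x < \<omega>" if "x \<le> B i" for x
      using that B(3) [of i] by (meson ereal_less_eq(3) order.strict_trans1)
    have aB: "a \<le> B i"
      using B(2) [of i] by simp
    have "(\<integral>\<^sup>+x. ennreal (p x) * indicator {a..B i} x \<partial>lborel) \<le> ennreal (q (B i) - q a)"
      using der le nonneg * aB by (intro nn_integral_le_antiderivative [of _ _ _ q']) auto
    also have "\<dots> \<le> ennreal K"
      using upper aB * by (intro ennreal_leI) auto
    finally show "(\<integral>\<^sup>+x. ennreal (p x) * indicator {a..B i} x \<partial>lborel) \<le> ennreal K" .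
  qed
  finally show ?thesis .
qed

section \<open>Partial maxima, and positive parts as layer-cake integrals\<close>

lemma pmax_1: "pmax w 1 = w 1"
  by (simp add: pmax_def)

lemma pmax_Suc: "1 \<le> k \<Longrightarrow> pmax w (Suc k) = max (pmax w k) (w (Suc k))"
  unfolding pmax_def by (simp add: atLeastAtMostSuc_conv max.commute)

lemma pmax_le_iff: "1 \<le> k \<Longrightarrow> pmax w k \<le> x \<longleftrightarrow> (\<forall>i\<in>{1..k}. w i \<le> x)"
  unfolding pmax_def by (subst Max_le_iff) auto

lemma spacing_eq_pos_part: "1 \<le> k \<Longrightarrow> spacing k w = max 0 (w (Suc k) - pmax w k)"
  by (simp add: spacing_def pmax_Suc)

lemma spacing_nonneg: "1 \<le> k \<Longrightarrow> 0 \<le> spacing k w"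
  by (simp add: spacing_eq_pos_part)

text \<open>The positive part is the length of the half-open interval from \<open>m\<close> to
  \<open>b\<close>. The product form keeps the factor in \<open>m\<close> (a partial maximum) apart
  from the factor in \<open>b\<close> (the next observation), which are independent.\<close>

lemma pos_part_eq_nn_integral:
  fixes b m :: real
  shows "ennreal (max 0 (b - m)) = (\<integral>\<^sup>+x. indicator {m..} x * indicator {..<b} x \<partial>lborel)"
proof -
  have "(\<integral>\<^sup>+x. indicator {m..} x * indicator {..<b} x \<partial>lborel)
      = (\<integral>\<^sup>+x. indicator {m..<b} x \<partial>lborel)"
    by (intro nn_integral_cong) (auto simp: indicator_def)
  also have "\<dots> = ennreal (max 0 (b - m))"
    by (cases "m \<le> b") (auto simp: max_def)
  finally show ?thesis ..
qed

text \<open>For \<open>m \<le> b\<close> the integrand \<open>2 * (b - x)\<close> has antiderivative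
  \<open>- (b - x)\<^sup>2\<close>. The positive part left inside can be expanded once more by the
  previous formula.\<close>

lemma pos_part_square_eq_nn_integral:
  fixes b m :: real
  shows "ennreal ((max 0 (b - m))\<^sup>2)
    = (\<integral>\<^sup>+x. 2 * (indicator {m..} x * ennreal (max 0 (b - x))) \<partial>lborel)"
proof (cases "m \<le> b")
  case True
  have "((\<lambda>x. 2 * (b - x)) has_integral (- (b - b)\<^sup>2 - - (b - m)\<^sup>2)) {m..b}"
    using True
    by (intro fundamental_theorem_of_calculus)
       (auto simp: has_real_derivative_iff_has_vector_derivative [symmetric]
             intro!: derivative_eq_intros)
  then have "(\<integral>\<^sup>+x. ennreal (2 * (b - x)) * indicator {m..b} x \<partial>lborel) = ennreal ((b - m)\<^sup>2)"
    using nn_integral_has_integral_lebesgue' [of "{m..b}" "\<lambda>x. 2 * (b - x)"] by simp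
  moreover have "(\<integral>\<^sup>+x. ennreal (2 * (b - x)) * indicator {m..b} x \<partial>lborel)
      = (\<integral>\<^sup>+x. 2 * (indicator {m..} x * ennreal (max 0 (b - x))) \<partial>lborel)"
    by (intro nn_integral_cong)
       (auto simp: indicator_def max_def ennreal_mult' simp del: right_diff_distrib_numeral)
  ultimately show ?thesis
    using True by (simp add: max_def)
next
  case False
  then have "2 * (indicator {m..} x * ennreal (max 0 (b - x))) = 0" for x
    by (auto simp: indicator_def max_def)
  then have "(\<integral>\<^sup>+x. 2 * (indicator {m..} x * ennreal (max 0 (b - x))) \<partial>lborel) = 0"
    by (simp only: nn_integral_const mult_zero_left)
  with False show ?thesis by (simp add: max_def)
qed

section \<open>The i.i.d. model: measurability and square integrability\<close>

locale square_integrable_distribution = real_distribution D for D :: "real measure" +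
  assumes integrable_square: "integrable D (\<lambda>x. x\<^sup>2)"
begin

abbreviation "P \<equiv> iid_model D"

sublocale coords: product_prob_space "\<lambda>_. D" "UNIV :: nat set" ..

sublocale iid: prob_space P
  unfolding iid_model_def by (rule coords.P.prob_space_axioms)

lemma measurable_coord [measurable]: "(\<lambda>w. w i) \<in> borel_measurable P"
  unfolding iid_model_def by measurable

lemma measurable_pmax [measurable]: "1 \<le> k \<Longrightarrow> (\<lambda>w. pmax w k) \<in> borel_measurable P"
proof (induction k rule: dec_induct)
  case base
  then show ?case by (simp only: pmax_1) measurable
next
  case (step k)
  note [measurable] = step.IH
  show ?case
    using step.hyps by (simp add: pmax_Suc)
qed

lemma measurable_spacing [measurable]: "1 \<le> k \<Longrightarrow> spacing k \<in> borel_measurable P"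
  using measurable_pmax [of k] measurable_pmax [of "k + 1"]
  by (simp add: spacing_def [abs_def])

lemma measurable_coord_snd [measurable]: "(\<lambda>p. snd p i) \<in> borel_measurable (N \<Otimes>\<^sub>M P)"
  by (rule measurable_compose [OF measurable_snd measurable_coord])

lemma measurable_pmax_snd:
  "1 \<le> k \<Longrightarrow> (\<lambda>p. pmax (snd p) k) \<in> borel_measurable (N \<Otimes>\<^sub>M P)"
  by (rule measurable_compose [OF measurable_snd measurable_pmax])

lemma integrable_coord_square: "integrable P (\<lambda>w. (w i)\<^sup>2)"
proof -
  have "distr P D (\<lambda>w. w i) = D"
    unfolding iid_model_def by (rule coords.PiM_component) simp
  moreover have "(\<lambda>w. w i) \<in> measurable P D"
    using measurable_coord by (simp cong: measurable_cong_sets)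
  ultimately show ?thesis
    using integrable_distr [of "\<lambda>w. w i" P D "\<lambda>x. x\<^sup>2"] integrable_square by simp
qed

text \<open>The maximum is attained at some coordinate, so its square is one of the
  summands.\<close>

lemma pmax_square_le: "1 \<le> k \<Longrightarrow> (pmax w k)\<^sup>2 \<le> (\<Sum>i=1..k. (w i)\<^sup>2)"
proof -
  assume "1 \<le> k"
  then have "pmax w k \<in> w ` {1..k}"
    unfolding pmax_def by (intro Max_in) auto
  then obtain i where "i \<in> {1..k}" "pmax w k = w i" by auto
  then show ?thesis
    using member_le_sum [of i "{1..k}" "\<lambda>i. (w i)\<^sup>2"] by simp
qed

lemma integrable_pmax_square: "1 \<le> k \<Longrightarrow> integrable P (\<lambda>w. (pmax w k)\<^sup>2)"
  by (rule Bochner_Integration.integrable_bound [of _ "\<lambda>w. \<Sum>i=1..k. (w i)\<^sup>2"])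
     (auto simp: sum_nonneg pmax_square_le [simplified] integrable_coord_square)

lemma integrable_spacing_square: "1 \<le> k \<Longrightarrow> integrable P (\<lambda>w. (spacing k w)\<^sup>2)"
proof -
  assume k: "1 \<le> k"
  note [measurable] = measurable_spacing [OF k]
  have "(spacing k w)\<^sup>2 \<le> 2 * (pmax w (Suc k))\<^sup>2 + 2 * (pmax w k)\<^sup>2" for w
    using sum_squares_bound [of "pmax w (Suc k)" "- pmax w k"]
    by (simp add: spacing_def power2_diff)
  then show ?thesis
    using integrable_pmax_square [of k] integrable_pmax_square [of "Suc k"] k
    by (intro Bochner_Integration.integrable_bound [of P
          "\<lambda>w. 2 * (pmax w (Suc k))\<^sup>2 + 2 * (pmax w k)\<^sup>2" "\<lambda>w. (spacing k w)\<^sup>2"]) simp_all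
qed

lemma integrable_spacing: "1 \<le> k \<Longrightarrow> integrable P (spacing k)"
  by (rule iid.square_integrable_imp_integrable [OF measurable_spacing integrable_spacing_square])

lemma borel_measurable_cdf [measurable]: "cdf D \<in> borel_measurable borel"
  by (intro borel_measurable_mono) (simp add: mono_def cdf_nondecreasing)

section \<open>Tonelli formulas for the first two moments of a spacing\<close>

lemma emeasure_pmax_le_coord_gt:
  assumes "1 \<le> k"
  shows "emeasure P {w \<in> space P. pmax w k \<le> x \<and> y < w (Suc k)}
    = ennreal (cdf D x ^ k) * ennreal (1 - cdf D y)"
proof -
  let ?X = "\<lambda>i. if i \<le> k then {..x} else {y<..}"
  \<comment> \<open>The event is a box: coordinates 1 to \<open>k\<close> lie at or below
    \<open>x\<close>, coordinate \<open>Suc k\<close> lies above \<open>y\<close>. The product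
    measure of a box factorises.\<close>
  have "{w \<in> space P. pmax w k \<le> x \<and> y < w (Suc k)}
      = {w \<in> space P. \<forall>i\<in>{1..Suc k}. w i \<in> ?X i}"
    using assms by (auto simp: pmax_le_iff le_Suc_eq)
  also have "emeasure P \<dots> = (\<Prod>i\<in>{1..Suc k}. emeasure D (?X i))"
    unfolding iid_model_def by (rule coords.emeasure_PiM_Collect) auto
  also have "\<dots> = (\<Prod>i\<in>{1..k}. emeasure D {..x}) * emeasure D {y<..}"
    by (simp add: prod.cl_ivl_Suc)
  also have "emeasure D {..x} = ennreal (cdf D x)"
    by (simp add: emeasure_eq_measure cdf_def)
  also have "emeasure D {y<..} = ennreal (1 - cdf D y)"
  proof -
    have "{y<..} = UNIV - {..y}" by auto
    then show ?thesis
      using prob_compl [of "{..y}"] by (simp add: emeasure_eq_measure cdf_def)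
  qed
  finally show ?thesis
    by (simp add: ennreal_power cdf_nonneg)
qed

lemma nn_integral_pmax_le_coord_gt:
  assumes "1 \<le> k"
  shows "(\<integral>\<^sup>+w. indicator {pmax w k..} x * indicator {..<w (Suc k)} y \<partial>P)
    = ennreal (cdf D x ^ k) * ennreal (1 - cdf D y)"
proof -
  note [measurable] = measurable_pmax [OF assms]
  have "(\<integral>\<^sup>+w. indicator {pmax w k..} x * indicator {..<w (Suc k)} y \<partial>P)
      = (\<integral>\<^sup>+w. indicator {w \<in> space P. pmax w k \<le> x \<and> y < w (Suc k)} w \<partial>P)"
    by (intro nn_integral_cong) (auto simp: indicator_def)
  then show ?thesis
    using emeasure_pmax_le_coord_gt [OF assms] by simp
qed

lemma nn_integral_spacing:
  assumes "1 \<le> k"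
  shows "(\<integral>\<^sup>+w. ennreal (spacing k w) \<partial>P)
    = (\<integral>\<^sup>+x. ennreal (cdf D x ^ k) * ennreal (1 - cdf D x) \<partial>lborel)"
proof -
  note [measurable] = measurable_pmax [OF assms] measurable_pmax_snd [OF assms]
  interpret Q: pair_sigma_finite lborel P ..
  have "(\<integral>\<^sup>+w. ennreal (spacing k w) \<partial>P)
      = (\<integral>\<^sup>+w. \<integral>\<^sup>+x. indicator {pmax w k..} x * indicator {..<w (Suc k)} x \<partial>lborel \<partial>P)"
    by (simp only: spacing_eq_pos_part [OF assms] pos_part_eq_nn_integral)
  also have "\<dots> = (\<integral>\<^sup>+x. \<integral>\<^sup>+w. indicator {pmax w k..} x * indicator {..<w (Suc k)} x \<partial>P \<partial>lborel)"
    unfolding indicator_def atLeast_iff lessThan_iff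
    by (rule Q.Fubini') measurable
  finally show ?thesis
    by (simp only: nn_integral_pmax_le_coord_gt [OF assms])
qed

text \<open>The integrated tail, that is the expectation of \<open>max 0 (X - x)\<close> for
  \<open>X\<close> with law \<open>D\<close>; it is not divided by the tail probability. Values in
  \<open>ennreal\<close> allow Tonelli without a finiteness argument.\<close>

definition mean_excess :: "real \<Rightarrow> ennreal" where
  "mean_excess x = (\<integral>\<^sup>+y. indicator {x..} y * ennreal (1 - cdf D y) \<partial>lborel)"

lemma measurable_mean_excess [measurable]: "mean_excess \<in> borel_measurable borel"
proof -
  have "(\<lambda>x. \<integral>\<^sup>+y. (if x \<le> y then 1 else 0) * ennreal (1 - cdf D y) \<partial>lborel)
      \<in> borel_measurable borel"
    by measurable
  then show ?thesis
    by (simp add: mean_excess_def [abs_def] indicator_def [abs_def])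
qed

text \<open>Tonelli is used twice: first for the layer-cake form of the square, then for the
  positive part that it leaves. Independence pulls out the factor F(x)^k, and the rest integrates to
  \<open>mean_excess x\<close>.\<close>

lemma nn_integral_spacing_square:
  assumes "1 \<le> k"
  shows "(\<integral>\<^sup>+w. ennreal ((spacing k w)\<^sup>2) \<partial>P)
    = (\<integral>\<^sup>+x. 2 * (ennreal (cdf D x ^ k) * mean_excess x) \<partial>lborel)"
proof -
  note [measurable] = measurable_pmax [OF assms] measurable_pmax_snd [OF assms]
  interpret Q: pair_sigma_finite lborel P ..
  have "(\<integral>\<^sup>+w. ennreal ((spacing k w)\<^sup>2) \<partial>P)
      = (\<integral>\<^sup>+w. \<integral>\<^sup>+x. 2 * (indicator {pmax w k..} x * ennreal (max 0 (w (Suc k) - x))) \<partial>lborel \<partial>P)"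
    by (simp only: spacing_eq_pos_part [OF assms] pos_part_square_eq_nn_integral)
  also have "\<dots> = (\<integral>\<^sup>+x. \<integral>\<^sup>+w. 2 * (indicator {pmax w k..} x * ennreal (max 0 (w (Suc k) - x))) \<partial>P \<partial>lborel)"
    unfolding indicator_def atLeast_iff lessThan_iff
    by (rule Q.Fubini') measurable
  also have "\<dots> = (\<integral>\<^sup>+x. 2 * (ennreal (cdf D x ^ k) * mean_excess x) \<partial>lborel)"
  proof (rule nn_integral_cong)
    fix x :: real
    have "(\<integral>\<^sup>+w. 2 * (indicator {pmax w k..} x * ennreal (max 0 (w (Suc k) - x))) \<partial>P)
        = 2 * (\<integral>\<^sup>+w. indicator {pmax w k..} x * ennreal (max 0 (w (Suc k) - x)) \<partial>P)"
      unfolding indicator_def atLeast_iff by (rule nn_integral_cmult) measurable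
    also have "(\<integral>\<^sup>+w. indicator {pmax w k..} x * ennreal (max 0 (w (Suc k) - x)) \<partial>P)
        = (\<integral>\<^sup>+w. \<integral>\<^sup>+y. indicator {pmax w k..} x * (indicator {x..} y * indicator {..<w (Suc k)} y) \<partial>lborel \<partial>P)"
      by (subst nn_integral_cmult) (simp_all only: pos_part_eq_nn_integral, measurable)
    also have "\<dots> = (\<integral>\<^sup>+y. \<integral>\<^sup>+w. indicator {pmax w k..} x * (indicator {x..} y * indicator {..<w (Suc k)} y) \<partial>P \<partial>lborel)"
      unfolding indicator_def atLeast_iff lessThan_iff
      by (rule Q.Fubini') measurable
    also have "\<dots> = (\<integral>\<^sup>+y. indicator {x..} y * (ennreal (cdf D x ^ k) * ennreal (1 - cdf D y)) \<partial>lborel)"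
    proof (rule nn_integral_cong)
      fix y :: real
      show "(\<integral>\<^sup>+w. indicator {pmax w k..} x * (indicator {x..} y * indicator {..<w (Suc k)} y) \<partial>P)
          = indicator {x..} y * (ennreal (cdf D x ^ k) * ennreal (1 - cdf D y))"
        using nn_integral_pmax_le_coord_gt [OF assms, of x y]
        by (cases "x \<le> y") simp_all
    qed
    also have "\<dots> = ennreal (cdf D x ^ k) * mean_excess x"
      unfolding mean_excess_def
      by (subst nn_integral_cmult [symmetric]) (auto simp: mult.left_commute)
    finally show "(\<integral>\<^sup>+w. 2 * (indicator {pmax w k..} x * ennreal (max 0 (w (Suc k) - x))) \<partial>P)
        = 2 * (ennreal (cdf D x ^ k) * mean_excess x)" .
  qed
  finally show ?thesis .
qed

end

section \<open>Tail asymptotics\<close>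

context square_integrable_distribution
begin

text \<open>The mean is the integral of F^k (1 - F). Restricted to the interval from
  \<open>x\<close> to \<open>y\<close>, the first factor is smallest at \<open>x\<close> and the
  second at \<open>y\<close>.\<close>

lemma expectation_spacing_ge:
  assumes "1 \<le> k" "x \<le> y"
  shows "(y - x) * (cdf D x ^ k * (1 - cdf D y)) \<le> iid.expectation (spacing k)"
proof -
  have "ennreal ((y - x) * (cdf D x ^ k * (1 - cdf D y)))
      = (\<integral>\<^sup>+z. ennreal (cdf D x ^ k * (1 - cdf D y)) * indicator {x..y} z \<partial>lborel)"
    using assms cdf_bounded_prob [of y]
    by (subst nn_integral_cmult_indicator) (simp_all add: ennreal_mult' mult.commute)
  also have "\<dots> \<le> (\<integral>\<^sup>+z. ennreal (cdf D z ^ k) * ennreal (1 - cdf D z) \<partial>lborel)"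
  proof (intro nn_integral_mono)
    fix z
    have "cdf D x ^ k * (1 - cdf D y) \<le> cdf D z ^ k * (1 - cdf D z)" if "x \<le> z" "z \<le> y"
      using that cdf_bounded_prob [of y]
      by (intro mult_mono power_mono) (auto simp: cdf_nondecreasing cdf_nonneg)
    then show "ennreal (cdf D x ^ k * (1 - cdf D y)) * indicator {x..y} z
        \<le> ennreal (cdf D z ^ k) * ennreal (1 - cdf D z)"
      by (auto simp: indicator_def ennreal_mult'' [symmetric] cdf_bounded_prob
               intro: ennreal_leI)
  qed
  also have "\<dots> = ennreal (iid.expectation (spacing k))"
    using nn_integral_spacing [OF assms(1)] integrable_spacing [OF assms(1)] spacing_nonneg [OF assms(1)]
    by (simp add: nn_integral_eq_integral)
  finally show ?thesis
    using spacing_nonneg [OF assms(1)] by (simp add: integral_nonneg_AE)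
qed

end

text \<open>Raise 1 + s \<le> max 1 r * exp (s / r) to the power \<open>r\<close>. It trades the
  exponential for a power of 1 + s, so that an explicit antiderivative becomes available.\<close>

lemma exp_minus_le_powr:
  fixes r s :: real
  assumes "0 < r" "0 \<le> s"
  shows "exp (- s) \<le> max 1 r powr r * (1 + s) powr (- r)"
proof -
  \<comment> \<open>For r \<ge> 1 the right-hand side is r + s; for r < 1 it is 1 + s / r.\<close>
  have "1 + s \<le> max 1 r * (1 + s / r)"
    using assms mult_left_le_one_le [of s r] by (auto simp: max_def field_simps)
  also have "\<dots> \<le> max 1 r * exp (s / r)"
    using assms by (intro mult_left_mono exp_ge_add_one_self) auto
  finally have "(1 + s) powr r \<le> (max 1 r * exp (s / r)) powr r"
    using assms by (intro powr_mono2) auto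
  also have "\<dots> = max 1 r powr r * exp s"
    using assms by (simp add: powr_mult exp_powr_real)
  finally show ?thesis
    using assms by (simp add: powr_minus exp_minus field_simps)
qed

section \<open>Tail integrals under a two-sided bound on the density\<close>

text \<open>Common form of both growth conditions on a neighbourhood of \<open>\<omega>\<close> that
  is small enough: the bounds on the liminf and limsup become constants \<open>a\<close> and
  \<open>b\<close>, the logarithmic factor is at least 1, and every level from
  \<open>p\<^sub>0\<close> up to 1 is attained by the distribution function inside the
  neighbourhood.\<close>

locale regular_tail = square_integrable_distribution D for D :: "real measure" +
  fixes f :: "real \<Rightarrow> real" and M a b \<gamma> \<delta> p\<^sub>0 :: real and \<omega> :: ereal
  assumes deriv: "\<And>x. M < x \<Longrightarrow> ereal x < \<omega> \<Longrightarrow> (cdf D has_real_derivative f x) (at x)"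
    and cdf_less_1: "\<And>x. M < x \<Longrightarrow> ereal x < \<omega> \<Longrightarrow> cdf D x < 1"
    and cdf_eq_1: "\<And>x. \<omega> \<le> ereal x \<Longrightarrow> cdf D x = 1"
    and log_ge_1: "\<And>x. M < x \<Longrightarrow> ereal x < \<omega> \<Longrightarrow> 1 \<le> - ln (1 - cdf D x)"
    and a_pos: "0 < a" and b_pos: "0 < b" and \<gamma>_less: "\<gamma> < 3 / 2" and \<delta>_nonneg: "0 \<le> \<delta>"
    and density_ge: "\<And>x. M < x \<Longrightarrow> ereal x < \<omega> \<Longrightarrow>
      a * ((1 - cdf D x) powr \<gamma> * (- ln (1 - cdf D x)) powr \<delta>) \<le> f x"
    and density_le: "\<And>x. M < x \<Longrightarrow> ereal x < \<omega> \<Longrightarrow>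
      f x \<le> b * ((1 - cdf D x) powr \<gamma> * (- ln (1 - cdf D x)) powr \<delta>)"
    and p\<^sub>0_less: "p\<^sub>0 < 1"
    and quantile: "\<And>p. p\<^sub>0 \<le> p \<Longrightarrow> p < 1 \<Longrightarrow> \<exists>x. M < x \<and> ereal x < \<omega> \<and> cdf D x = p"
begin

abbreviation G :: "real \<Rightarrow> real" where "G x \<equiv> 1 - cdf D x"
abbreviation \<Lambda> :: "real \<Rightarrow> real" where "\<Lambda> x \<equiv> - ln (G x)"

lemma deriv_G: "M < x \<Longrightarrow> ereal x < \<omega> \<Longrightarrow> (G has_real_derivative - f x) (at x)"
  using deriv by (auto intro!: derivative_eq_intros)

lemma density_nonneg: "M < x \<Longrightarrow> ereal x < \<omega> \<Longrightarrow> 0 \<le> f x"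
  using a_pos by (intro order_trans [OF _ density_ge]) auto

lemma \<Lambda>_mono: "M < x \<Longrightarrow> x \<le> y \<Longrightarrow> ereal y < \<omega> \<Longrightarrow> \<Lambda> x \<le> \<Lambda> y"
  using cdf_less_1 [of y] cdf_nondecreasing [of x y] by simp

lemma mean_excess_zero: "\<omega> \<le> ereal x \<Longrightarrow> mean_excess x = 0"
proof -
  assume "\<omega> \<le> ereal x"
  then have "indicator {x..} y * ennreal (G y) = 0" for y
    using cdf_eq_1 [of y] order_trans [of \<omega> "ereal x" "ereal y"] by (auto simp: indicator_def)
  then show ?thesis
    by (simp only: mean_excess_def nn_integral_const mult_zero_left)
qed

text \<open>The density bound gives G \<le> G^(1 - \<gamma>) f / (a \<Lambda>^\<delta>), where
  \<Lambda> may be frozen at \<open>x\<close> since it increases. Up to the factor 2 - \<gamma>, the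
  function - G^(2 - \<gamma>) is an antiderivative of G^(1 - \<gamma>) f.\<close>

lemma mean_excess_le:
  assumes "M < x" "ereal x < \<omega>"
  shows "mean_excess x \<le> ennreal (G x powr (2 - \<gamma>) * \<Lambda> x powr (- \<delta>) / (a * (2 - \<gamma>)))"
proof -
  define c where "c = \<Lambda> x powr (- \<delta>) / a"
  have c: "0 \<le> c"
    using a_pos by (simp add: c_def)
  have "mean_excess x = (\<integral>\<^sup>+y. ennreal (G y) * indicator {y. x \<le> y \<and> ereal y < \<omega>} y \<partial>lborel)"
    unfolding mean_excess_def
    by (intro nn_integral_cong) (auto simp: indicator_def not_less cdf_eq_1)
  also have "\<dots> \<le> ennreal (c / (2 - \<gamma>) * G x powr (2 - \<gamma>))"
  proof (rule nn_integral_le_antiderivative_up_to)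
    fix y assume y: "x \<le> y" "ereal y < \<omega>"
    then have My: "M < y" and Gy: "0 < G y"
      using assms cdf_less_1 [of y] by auto
    show "((\<lambda>y. - (c / (2 - \<gamma>)) * G y powr (2 - \<gamma>)) has_real_derivative c * (G y powr (1 - \<gamma>) * f y)) (at y)"
      using DERIV_cmult [OF DERIV_fun_powr [OF deriv_G [OF My y(2)] Gy, of "2 - \<gamma>"], of "- (c / (2 - \<gamma>))"]
        \<gamma>_less by simp
    show "0 \<le> c * (G y powr (1 - \<gamma>) * f y)"
      using c density_nonneg [OF My y(2)] by simp
    have L: "1 \<le> \<Lambda> x" "\<Lambda> x \<le> \<Lambda> y"
      using log_ge_1 [OF assms] \<Lambda>_mono [OF assms(1) y] by auto
    have "G y = c * (G y powr (1 - \<gamma>) * (a * (G y powr \<gamma> * \<Lambda> x powr \<delta>)))"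
      using a_pos L Gy by (simp add: c_def powr_minus powr_add [symmetric] field_simps)
    also have "\<dots> \<le> c * (G y powr (1 - \<gamma>) * (a * (G y powr \<gamma> * \<Lambda> y powr \<delta>)))"
      using a_pos c L \<delta>_nonneg by (intro mult_left_mono powr_mono2) auto
    also have "\<dots> \<le> c * (G y powr (1 - \<gamma>) * f y)"
      using c density_ge [OF My y(2)] by (intro mult_left_mono) auto
    finally show "G y \<le> c * (G y powr (1 - \<gamma>) * f y)" .
    show "- (c / (2 - \<gamma>)) * G y powr (2 - \<gamma>) - (- (c / (2 - \<gamma>)) * G x powr (2 - \<gamma>))
        \<le> c / (2 - \<gamma>) * G x powr (2 - \<gamma>)"
      using c \<gamma>_less by simp
  qed (use assms in auto)
  finally show ?thesis
    by (simp add: c_def mult_ac)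
qed

text \<open>The power of the maximum comes from \<open>exp_minus_le_powr\<close> with exponent 4 - 2
  \<gamma>, one factor a (2 - \<gamma>) from \<open>mean_excess_le\<close>, the other
  \<open>a\<close> from bringing in the density, and 3 - 2 \<gamma> from the antiderivative. The
  condition \<gamma> < 3/2 makes this last factor positive.\<close>

definition tail_const :: real where
  "tail_const = 2 * max 1 (4 - 2 * \<gamma>) powr (4 - 2 * \<gamma>) / (a\<^sup>2 * (2 - \<gamma>) * (3 - 2 * \<gamma>))"

lemma tail_const_nonneg: "0 \<le> tail_const"
  using \<gamma>_less by (simp add: tail_const_def)

text \<open>The antiderivative is a multiple of \<open>(s / (1 + s)) powr (3 - 2 * \<gamma>)\<close> with \<open>s = k * G x\<close>:
  it is bounded by 1, and its derivative dominates \<open>exp (- s) * s powr (2 - 2 * \<gamma>)\<close>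
  up to a constant, which replaces an evaluation of the Beta integral.\<close>

lemma nn_integral_tail_le:
  assumes "1 \<le> k" "M < u" "ereal u < \<omega>"
  shows "(\<integral>\<^sup>+x. ennreal (2 * cdf D x ^ k * (G x powr (2 - \<gamma>) * \<Lambda> x powr (- \<delta>) / (a * (2 - \<gamma>))))
      * indicator {x. u \<le> x \<and> ereal x < \<omega>} x \<partial>lborel)
    \<le> ennreal (tail_const * \<Lambda> u powr (- 2 * \<delta>) * real k powr (2 * \<gamma> - 3))"
proof -
  \<comment> \<open>The exponent of G that remains after G^(2 - \<gamma>) is divided by G^\<gamma>.
    That it exceeds -1 is precisely \<gamma> < 3/2, and gives integrability at s = 0.\<close>
  define \<beta> where "\<beta> = 2 - 2 * \<gamma>"
  have \<beta>: "- 1 < \<beta>"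
    using \<gamma>_less by (simp add: \<beta>_def)
  define E where "E = max 1 (\<beta> + 2) powr (\<beta> + 2)"
  define K where "K = tail_const * \<Lambda> u powr (- 2 * \<delta>) * real k powr (2 * \<gamma> - 3)"
  have K: "0 \<le> K"
    using tail_const_nonneg by (simp add: K_def)
  define t where "t = (\<lambda>x. real k * G x / (1 + real k * G x))"
  define q where "q = (\<lambda>x. - K * t x powr (\<beta> + 1))"
  define q' where "q' = (\<lambda>x. K * (\<beta> + 1) * t x powr \<beta> * (real k * f x / (1 + real k * G x)\<^sup>2))"
  have "(\<integral>\<^sup>+x. ennreal (2 * cdf D x ^ k * (G x powr (2 - \<gamma>) * \<Lambda> x powr (- \<delta>) / (a * (2 - \<gamma>))))
      * indicator {x. u \<le> x \<and> ereal x < \<omega>} x \<partial>lborel) \<le> ennreal K"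
  proof (rule nn_integral_le_antiderivative_up_to [where q = q and q' = q'])
    fix x assume x: "u \<le> x" "ereal x < \<omega>"
    then have Mx: "M < x" and Gx: "0 < G x"
      using assms cdf_less_1 [of x] by auto
    define s where "s = real k * G x"
    have s: "0 < s"
      using Gx assms by (simp add: s_def)
    have t: "t x = s / (1 + s)"
      by (simp add: t_def s_def)
    have t_pos: "0 < t x"
      using s by (simp add: t)
    have "(t has_real_derivative - (real k * f x / (1 + real k * G x)\<^sup>2)) (at x)"
      unfolding t_def using s deriv [OF Mx x(2)]
      by (auto intro!: derivative_eq_intros simp: s_def field_simps power2_eq_square)
    from DERIV_cmult [OF DERIV_fun_powr [OF this t_pos, of "\<beta> + 1"], of "- K"]
    show "(q has_real_derivative q' x) (at x)"
      by (simp add: q_def q'_def mult_ac)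
    show q'_nonneg: "0 \<le> q' x"
      using K \<beta> density_nonneg [OF Mx x(2)] by (simp add: q'_def)
    show "q x - q u \<le> K"
    proof -
      have "t u \<le> 1" "0 \<le> t u"
        using assms cdf_less_1 [of u] by (auto simp: t_def divide_simps add_pos_nonneg)
      then have "t u powr (\<beta> + 1) \<le> 1"
        using \<beta> by (intro powr_le1) auto
      then have "K * t u powr (\<beta> + 1) \<le> K" "0 \<le> K * t x powr (\<beta> + 1)"
        using K by (auto intro: mult_left_le)
      then show ?thesis
        by (simp add: q_def)
    qed
    have L: "1 \<le> \<Lambda> u" "\<Lambda> u \<le> \<Lambda> x"
      using log_ge_1 [of u] \<Lambda>_mono [of u x] assms x by auto
    have F_le: "cdf D x ^ k \<le> E * (1 + s) powr (- (\<beta> + 2))"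
    proof -
      \<comment> \<open>From F = 1 - G \<le> exp (- G).\<close>
      have "cdf D x ^ k \<le> exp (- G x) ^ k"
        using exp_ge_add_one_self [of "- G x"] by (intro power_mono) (auto simp: cdf_nonneg)
      also have "\<dots> = exp (- s)"
        by (simp add: s_def exp_of_nat_mult [symmetric] algebra_simps)
      also have "\<dots> \<le> E * (1 + s) powr (- (\<beta> + 2))"
        unfolding E_def using s \<beta> by (intro exp_minus_le_powr) auto
      finally show ?thesis .
    qed
    \<comment> \<open>Multiplying by this factor brings the density into the integrand, as the
      substitution s = k G requires.\<close>
    have f_ge: "1 \<le> f x / (a * (G x powr \<gamma> * \<Lambda> x powr \<delta>))"
    proof -
      have "0 < a * (G x powr \<gamma> * \<Lambda> x powr \<delta>)"
        using a_pos Gx L by (intro mult_pos_pos) auto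
      then show ?thesis
        using density_ge [OF Mx x(2)] by simp
    qed
    have "2 * cdf D x ^ k * (G x powr (2 - \<gamma>) * \<Lambda> x powr (- \<delta>) / (a * (2 - \<gamma>)))
        \<le> 2 * (E * (1 + s) powr (- (\<beta> + 2)))
          * (G x powr (2 - \<gamma>) * \<Lambda> x powr (- \<delta>) / (a * (2 - \<gamma>)))
          * (f x / (a * (G x powr \<gamma> * \<Lambda> x powr \<delta>)))"
    proof -
      have "2 * cdf D x ^ k * (G x powr (2 - \<gamma>) * \<Lambda> x powr (- \<delta>) / (a * (2 - \<gamma>))) * 1
        \<le> 2 * (E * (1 + s) powr (- (\<beta> + 2)))
          * (G x powr (2 - \<gamma>) * \<Lambda> x powr (- \<delta>) / (a * (2 - \<gamma>)))
          * (f x / (a * (G x powr \<gamma> * \<Lambda> x powr \<delta>)))"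
        using F_le f_ge a_pos \<gamma>_less
        by (intro mult_mono mult_nonneg_nonneg divide_nonneg_nonneg) (auto simp: E_def cdf_nonneg)
      then show ?thesis by simp
    qed
    also have "\<dots> = 2 * E / (a\<^sup>2 * (2 - \<gamma>)) * f x * (1 + s) powr (- (\<beta> + 2))
        * (G x powr (2 - \<gamma>) / G x powr \<gamma>) * (\<Lambda> x powr (- \<delta>) / \<Lambda> x powr \<delta>)"
      by (simp add: power2_eq_square mult_ac)
    also have "G x powr (2 - \<gamma>) / G x powr \<gamma> = s powr \<beta> * real k powr (- \<beta>)"
    proof -
      have "G x = s / real k"
        using assms by (simp add: s_def)
      then have "G x powr \<beta> = s powr \<beta> * real k powr (- \<beta>)"
        using s by (simp add: powr_divide powr_minus_divide)
      then show ?thesis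
        by (simp add: powr_diff [symmetric] \<beta>_def)
    qed
    also have "\<Lambda> x powr (- \<delta>) / \<Lambda> x powr \<delta> = \<Lambda> x powr (- 2 * \<delta>)"
      by (simp add: powr_diff [symmetric])
    \<comment> \<open>The logarithmic factor is largest at the left end \<open>u\<close>, because
      \<Lambda> increases and its exponent is nonpositive.\<close>
    also have "2 * E / (a\<^sup>2 * (2 - \<gamma>)) * f x * (1 + s) powr (- (\<beta> + 2))
          * (s powr \<beta> * real k powr (- \<beta>)) * \<Lambda> x powr (- 2 * \<delta>)
        \<le> 2 * E / (a\<^sup>2 * (2 - \<gamma>)) * f x * (1 + s) powr (- (\<beta> + 2))
          * (s powr \<beta> * real k powr (- \<beta>)) * \<Lambda> u powr (- 2 * \<delta>)"
      using \<gamma>_less density_nonneg [OF Mx x(2)] L \<delta>_nonneg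
      by (intro mult_left_mono powr_mono2') (auto simp: E_def)
    also have "\<dots> = q' x"
    proof -
      have e1: "t x powr \<beta> = s powr \<beta> * (1 + s) powr (- \<beta>)"
        using s by (simp add: t powr_divide powr_minus_divide)
      have e2: "(1 + s) powr (- (\<beta> + 2)) = (1 + s) powr (- \<beta>) / (1 + s)\<^sup>2"
        using s by (simp add: powr_diff)
      have e3: "real k powr (- \<beta>) = real k powr (2 * \<gamma> - 3) * real k"
        using assms by (simp add: \<beta>_def powr_diff field_simps power3_eq_cube power2_eq_square)
      have e4: "2 * E / (a\<^sup>2 * (2 - \<gamma>)) = tail_const * (\<beta> + 1)"
        using \<gamma>_less a_pos by (simp add: tail_const_def E_def \<beta>_def)
      show ?thesis
        unfolding q'_def K_def s_def [symmetric] e1 e2 e3 e4 by (simp add: mult_ac)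
    qed
    finally show "2 * cdf D x ^ k * (G x powr (2 - \<gamma>) * \<Lambda> x powr (- \<delta>) / (a * (2 - \<gamma>))) \<le> q' x" .
  qed (use assms in auto)
  then show ?thesis
    by (simp add: K_def)
qed

text \<open>The integral of 2 F^k times the integrated tail is split at \<open>u\<close>. To the
  left all but one of the factors F are bounded by F(u), which leaves the integral for
  \<open>k = 1\<close>; to the right the tail estimate applies; from \<open>\<omega>\<close> on the
  integrand vanishes.\<close>

lemma expectation_spacing_square_le:
  assumes "1 \<le> k" "M < u" "ereal u < \<omega>"
  shows "iid.expectation (\<lambda>w. (spacing k w)\<^sup>2)
    \<le> cdf D u ^ (k - 1) * iid.expectation (\<lambda>w. (spacing 1 w)\<^sup>2)
      + tail_const * \<Lambda> u powr (- 2 * \<delta>) * real k powr (2 * \<gamma> - 3)"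
proof -
  have nn: "(\<integral>\<^sup>+x. 2 * (ennreal (cdf D x ^ j) * mean_excess x) \<partial>lborel)
      = ennreal (iid.expectation (\<lambda>w. (spacing j w)\<^sup>2))" if "1 \<le> j" for j
    using nn_integral_spacing_square [OF that] integrable_spacing_square [OF that]
    by (simp add: nn_integral_eq_integral)
  let ?p = "\<lambda>x. ennreal (2 * cdf D x ^ k * (G x powr (2 - \<gamma>) * \<Lambda> x powr (- \<delta>) / (a * (2 - \<gamma>))))
      * indicator {x. u \<le> x \<and> ereal x < \<omega>} x"
  have "ennreal (iid.expectation (\<lambda>w. (spacing k w)\<^sup>2))
      = (\<integral>\<^sup>+x. 2 * (ennreal (cdf D x ^ k) * mean_excess x) \<partial>lborel)"
    using nn assms by simp
  also have "\<dots> \<le> (\<integral>\<^sup>+x. ennreal (cdf D u ^ (k - 1)) * (2 * (ennreal (cdf D x ^ 1) * mean_excess x))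
      + ?p x \<partial>lborel)"
  proof (intro nn_integral_mono)
    fix x
    consider "x < u" | "u \<le> x" "ereal x < \<omega>" | "\<omega> \<le> ereal x"
      by force
    then show "2 * (ennreal (cdf D x ^ k) * mean_excess x)
      \<le> ennreal (cdf D u ^ (k - 1)) * (2 * (ennreal (cdf D x ^ 1) * mean_excess x)) + ?p x"
    proof cases
      case 1
      \<comment> \<open>One factor F must be kept: the integral of \<open>mean_excess\<close> alone
        over the half-line left of \<open>u\<close> is infinite.\<close>
      have "cdf D x ^ k = cdf D x ^ (k - 1) * cdf D x"
        using assms by (metis Suc_diff_1 less_le_trans power_Suc2 zero_less_one)
      also have "\<dots> \<le> cdf D u ^ (k - 1) * cdf D x"
        using 1 by (intro mult_right_mono power_mono) (auto simp: cdf_nonneg cdf_nondecreasing)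
      finally have "ennreal (cdf D x ^ k) \<le> ennreal (cdf D u ^ (k - 1)) * ennreal (cdf D x ^ 1)"
        by (simp add: ennreal_mult'' [symmetric] cdf_nonneg ennreal_leI)
      then have "2 * (ennreal (cdf D x ^ k) * mean_excess x)
          \<le> 2 * (ennreal (cdf D u ^ (k - 1)) * ennreal (cdf D x ^ 1) * mean_excess x)"
        by (intro mult_left_mono mult_right_mono) auto
      also have "\<dots> = ennreal (cdf D u ^ (k - 1)) * (2 * (ennreal (cdf D x ^ 1) * mean_excess x))"
        by (simp only: mult_ac)
      finally show ?thesis
        by (rule order_trans) simp
    next
      case 2
      then have "mean_excess x \<le> ennreal (G x powr (2 - \<gamma>) * \<Lambda> x powr (- \<delta>) / (a * (2 - \<gamma>)))"
        using assms by (intro mean_excess_le) auto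
      then have "2 * (ennreal (cdf D x ^ k) * mean_excess x)
          \<le> 2 * (ennreal (cdf D x ^ k) * ennreal (G x powr (2 - \<gamma>) * \<Lambda> x powr (- \<delta>) / (a * (2 - \<gamma>))))"
        by (intro mult_left_mono) auto
      also have "\<dots> = ?p x"
      proof -
        have "2 * (ennreal r * ennreal s) = ennreal (2 * r * s)" if "0 \<le> r" "0 \<le> s" for r s
          using that by (simp add: ennreal_mult mult.assoc)
        then show ?thesis
          using 2 a_pos \<gamma>_less by (simp add: cdf_nonneg)
      qed
      finally show ?thesis
        by (rule order_trans) simp
    next
      case 3
      then show ?thesis
        by (simp add: mean_excess_zero)
    qed
  qed
  also have "\<dots> = ennreal (cdf D u ^ (k - 1)) * ennreal (iid.expectation (\<lambda>w. (spacing 1 w)\<^sup>2))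
      + (\<integral>\<^sup>+x. ?p x \<partial>lborel)"
    by (simp add: nn_integral_add nn_integral_cmult nn [of 1, simplified])
  also have "\<dots> \<le> ennreal (cdf D u ^ (k - 1)) * ennreal (iid.expectation (\<lambda>w. (spacing 1 w)\<^sup>2))
      + ennreal (tail_const * \<Lambda> u powr (- 2 * \<delta>) * real k powr (2 * \<gamma> - 3))"
    using assms by (intro add_left_mono nn_integral_tail_le)
  also have "\<dots> = ennreal (cdf D u ^ (k - 1) * iid.expectation (\<lambda>w. (spacing 1 w)\<^sup>2)
      + tail_const * \<Lambda> u powr (- 2 * \<delta>) * real k powr (2 * \<gamma> - 3))"
    using tail_const_nonneg by (simp add: ennreal_plus ennreal_mult'' cdf_nonneg)
  finally show ?thesis
    using tail_const_nonneg
    by (subst (asm) ennreal_le_iff) (auto simp: cdf_nonneg intro!: add_nonneg_nonneg mult_nonneg_nonneg)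
qed

section \<open>Asymptotic moment bounds from quantiles\<close>

lemma eventually_quantile_above:
  assumes "(q \<longlonglongrightarrow> 0)" shows "eventually (\<lambda>k. p\<^sub>0 \<le> 1 - q k) sequentially"
proof -
  have "((\<lambda>k. 1 - q k) \<longlonglongrightarrow> 1 - 0)"
    by (intro tendsto_intros assms)
  then have "eventually (\<lambda>k. p\<^sub>0 < 1 - q k) sequentially"
    using p\<^sub>0_less by (intro order_tendstoD(1)) auto
  then show ?thesis
    by (rule eventually_mono) simp
qed

text \<open>Between the two quantiles F grows by 1/k. By the mean value theorem this equals (y - x)
  f(z), and f(z) is at most of order k^(-\<gamma>) (ln k)^\<delta>, since G(z) lies between 1/k and
  2/k.\<close>

lemma quantile_spread_ge:
  assumes "3 \<le> k" and x: "M < x" "ereal y < \<omega>"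
    and cdf: "cdf D x = 1 - 2 / real k" "cdf D y = 1 - 1 / real k"
  shows "real k powr (\<gamma> - 1) * ln (real k) powr (- \<delta>) / (b * 2 powr \<bar>\<gamma>\<bar>) \<le> y - x"
proof -
  have "x < y"
  proof (rule ccontr)
    assume "\<not> x < y"
    then have "cdf D y \<le> cdf D x"
      by (simp add: cdf_nondecreasing)
    then have "2 / real k \<le> 1 / real k"
      unfolding cdf by simp
    with assms(1) show False
      by (simp add: divide_le_cancel)
  qed
  have range: "M < z \<and> ereal z < \<omega>" if "x \<le> z" "z \<le> y" for z
    using that x by (meson ereal_less_eq(3) order.strict_trans1 order.strict_trans2)
  obtain z where z: "x < z" "z < y" "cdf D y - cdf D x = (y - x) * f z"
    using MVT2 [OF \<open>x < y\<close>, of "cdf D" f] deriv range by blast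
  then have zr: "M < z" "ereal z < \<omega>"
    using range by auto
  define t where "t = real k * G z"
  have Gz: "1 / real k \<le> G z" "G z \<le> 2 / real k"
    using z cdf cdf_nondecreasing [of x z] cdf_nondecreasing [of z y] by auto
  then have t: "1 \<le> t" "t \<le> 2"
    using assms(1) by (auto simp: t_def field_simps)
  \<comment> \<open>Here 3 \<le> k serves through exp 1 \<le> 3.\<close>
  have ln_k: "1 \<le> ln (real k)"
  proof -
    have "exp 1 \<le> real k"
      using exp_le assms(1) by linarith
    then show ?thesis
      using assms(1) by (simp add: ln_ge_iff)
  qed
  have "G z = t / real k"
    using assms(1) by (simp add: t_def)
  then have "G z powr \<gamma> = t powr \<gamma> * real k powr (- \<gamma>)"
    using t by (simp add: powr_divide powr_minus_divide)
  \<comment> \<open>The sign of \<gamma> is unknown; passing to its absolute value covers both cases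
    because 1 \<le> t \<le> 2.\<close>
  also have "t powr \<gamma> \<le> t powr \<bar>\<gamma>\<bar>"
    using t by (intro powr_mono) auto
  also have "\<dots> \<le> 2 powr \<bar>\<gamma>\<bar>"
    using t by (intro powr_mono2) auto
  finally have G_le: "G z powr \<gamma> \<le> 2 powr \<bar>\<gamma>\<bar> * real k powr (- \<gamma>)"
    by (simp add: mult_right_mono)
  have "\<Lambda> z \<le> - ln (1 / real k)"
    using Gz(1) assms(1) by (simp del: ln_div) (metis Gz(1) divide_pos_pos ln_mono of_nat_0_less_iff
      less_le_trans zero_less_numeral zero_less_one)
  also have "\<dots> = ln (real k)"
    using assms(1) by (simp add: ln_div)
  finally have \<Lambda>_le: "\<Lambda> z powr \<delta> \<le> ln (real k) powr \<delta>"
    using log_ge_1 [OF zr] \<delta>_nonneg by (intro powr_mono2) auto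
  have "1 / real k = (y - x) * f z"
    using z(3) cdf by (simp add: diff_divide_distrib [symmetric])
  also have "\<dots> \<le> (y - x) * (b * (G z powr \<gamma> * \<Lambda> z powr \<delta>))"
    using \<open>x < y\<close> by (intro mult_left_mono density_le zr) auto
  also have "\<dots> \<le> (y - x) * (b * (2 powr \<bar>\<gamma>\<bar> * real k powr (- \<gamma>) * ln (real k) powr \<delta>))"
    using \<open>x < y\<close> b_pos by (intro mult_left_mono mult_mono G_le \<Lambda>_le) auto
  finally have "1 / real k \<le> (y - x) * (b * (2 powr \<bar>\<gamma>\<bar> * real k powr (- \<gamma>) * ln (real k) powr \<delta>))" .
  then show ?thesis
    using assms(1) b_pos ln_k by (simp add: powr_minus powr_diff field_simps)
qed

lemma expectation_spacing_asymp_ge: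
  "\<exists>c>0. eventually (\<lambda>k. c * (real k powr (\<gamma> - 2) * ln (real k) powr (- \<delta>))
     \<le> iid.expectation (spacing k)) sequentially"
proof (intro exI conjI)
  \<comment> \<open>The power (1 - 2/k)^k tends to exp (- 2), so it eventually exceeds exp (- 3);
    the denominator comes from the quantile spread.\<close>
  let ?c = "exp (- 3) / (b * 2 powr \<bar>\<gamma>\<bar>)"
  show "0 < ?c"
    using b_pos by simp
  have "(\<lambda>k. 2 / real k) \<longlonglongrightarrow> 0"
    by real_asymp
  note eventually_quantile_above [OF this]
  moreover have "eventually (\<lambda>k. exp (- 3) \<le> (1 - 2 / real k) ^ k) sequentially"
    by real_asymp
  moreover note eventually_ge_at_top [of "3 :: nat"]
  ultimately show "eventually (\<lambda>k. ?c * (real k powr (\<gamma> - 2) * ln (real k) powr (- \<delta>))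
     \<le> iid.expectation (spacing k)) sequentially"
  proof eventually_elim
    case (elim k)
    have "p\<^sub>0 \<le> 1 - 1 / real k"
      using elim by (auto intro: order_trans simp: divide_simps)
    then obtain x y where xy: "M < x" "ereal y < \<omega>" "cdf D x = 1 - 2 / real k" "cdf D y = 1 - 1 / real k"
      using quantile [of "1 - 2 / real k"] quantile [of "1 - 1 / real k"] elim by auto
    note spread = quantile_spread_ge [OF elim(3) xy]
    have "0 \<le> y - x"
      using b_pos by (intro order_trans [OF _ spread]) auto
    have "?c * (real k powr (\<gamma> - 2) * ln (real k) powr (- \<delta>))
        = real k powr (\<gamma> - 1) * ln (real k) powr (- \<delta>) / (b * 2 powr \<bar>\<gamma>\<bar>) * (exp (- 3) * (1 / real k))"
      using elim(3) by (simp add: powr_diff power2_eq_square mult_ac)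
    also have "\<dots> \<le> (y - x) * (cdf D x ^ k * (1 - cdf D y))"
      using spread elim \<open>0 \<le> y - x\<close> unfolding xy
      by (intro mult_mono) auto
    also have "\<dots> \<le> iid.expectation (spacing k)"
      using elim(3) \<open>0 \<le> y - x\<close> by (intro expectation_spacing_ge) auto
    finally show ?case .
  qed
qed

text \<open>Split at the quantile \<open>u\<close> of level 1 - 1 / sqrt k. There F(u)^(k - 1)
  decays roughly like exp (- sqrt k), faster than any power of k, while \<Lambda>(u) = (ln k) / 2,
  so freezing the logarithm at \<open>u\<close> costs only the constant 2^(2 \<delta>).\<close>

lemma expectation_spacing_square_asymp_le:
  "\<exists>C\<ge>0. eventually (\<lambda>k. iid.expectation (\<lambda>w. (spacing k w)\<^sup>2)
     \<le> C * (real k powr (2 * \<gamma> - 3) * ln (real k) powr (- 2 * \<delta>))) sequentially"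
proof (intro exI conjI)
  let ?S = "iid.expectation (\<lambda>w. (spacing 1 w)\<^sup>2)"
  let ?C = "?S + tail_const * 2 powr (2 * \<delta>)"
  show "0 \<le> ?C"
    using tail_const_nonneg by (simp add: integral_nonneg_AE)
  have "(\<lambda>k. 1 / sqrt (real k)) \<longlonglongrightarrow> 0"
    by real_asymp
  note eventually_quantile_above [OF this]
  moreover have "eventually (\<lambda>k. (1 - 1 / sqrt (real k)) ^ (k - 1)
      \<le> real k powr (2 * \<gamma> - 3) * ln (real k) powr (- 2 * \<delta>)) sequentially"
    by real_asymp
  moreover note eventually_ge_at_top [of "2 :: nat"]
  ultimately show "eventually (\<lambda>k. iid.expectation (\<lambda>w. (spacing k w)\<^sup>2)
     \<le> ?C * (real k powr (2 * \<gamma> - 3) * ln (real k) powr (- 2 * \<delta>))) sequentially"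
  proof eventually_elim
    case (elim k)
    obtain u where u: "M < u" "ereal u < \<omega>" "cdf D u = 1 - 1 / sqrt (real k)"
      using quantile [of "1 - 1 / sqrt (real k)"] elim by auto
    have "\<Lambda> u = ln (real k) / 2"
      using u elim(3) by (simp add: ln_div ln_sqrt)
    then have "\<Lambda> u powr (- 2 * \<delta>) = ln (real k) powr (- 2 * \<delta>) / 2 powr (- 2 * \<delta>)"
      using elim(3) by (simp only:) (simp add: powr_divide)
    then have "\<Lambda> u powr (- 2 * \<delta>) = 2 powr (2 * \<delta>) * ln (real k) powr (- 2 * \<delta>)"
      by (simp add: powr_minus [of 2] divide_inverse)
    moreover have "cdf D u ^ (k - 1) * ?S \<le> real k powr (2 * \<gamma> - 3) * ln (real k) powr (- 2 * \<delta>) * ?S"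
      unfolding u by (intro mult_right_mono elim(2)) (simp add: integral_nonneg_AE)
    ultimately show ?case
      using expectation_spacing_square_le [of k u] u elim(3) by (simp add: algebra_simps)
  qed
qed

text \<open>Two distinct quantiles of levels strictly between 0 and 1 make the lower bound positive
  for every \<open>k\<close>, including the small ones that the asymptotic bound leaves out.\<close>

lemma expectation_spacing_pos:
  assumes "1 \<le> k"
  shows "0 < iid.expectation (spacing k)"
proof -
  define p where "p = max p\<^sub>0 (1 / 2)"
  have p: "p < 1" "0 < p" "p\<^sub>0 \<le> p"
    using p\<^sub>0_less by (auto simp: p_def)
  obtain x where x: "M < x" "ereal x < \<omega>" "cdf D x = p"
    using quantile p by blast
  obtain y where y: "M < y" "ereal y < \<omega>" "cdf D y = (p + 1) / 2"
    using quantile [of "(p + 1) / 2"] p by auto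
  have "x < y"
  proof (rule ccontr)
    assume "\<not> x < y"
    then have "cdf D y \<le> cdf D x"
      by (simp add: cdf_nondecreasing)
    then show False
      using x y p by simp
  qed
  then have "0 < (y - x) * (cdf D x ^ k * (1 - cdf D y))"
    using x y p by (intro mult_pos_pos) auto
  also have "\<dots> \<le> iid.expectation (spacing k)"
    using assms \<open>x < y\<close> by (intro expectation_spacing_ge) auto
  finally show ?thesis .
qed

text \<open>The two asymptotic bounds match: k times the square of k^(\<gamma> - 2) (ln k)^(-
  \<delta>) is k^(2 \<gamma> - 3) (ln k)^(- 2 \<delta>). The finitely many remaining
  \<open>k\<close> are absorbed into the constant.\<close>

theorem spacing_moment_ratio:
  "\<exists>C. \<forall>k\<ge>1. iid.expectation (\<lambda>w. (spacing k w)\<^sup>2) \<le> C * real k * (iid.expectation (spacing k))\<^sup>2"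
proof -
  obtain c where c: "0 < c" "eventually (\<lambda>k. c * (real k powr (\<gamma> - 2) * ln (real k) powr (- \<delta>))
     \<le> iid.expectation (spacing k)) sequentially"
    using expectation_spacing_asymp_ge by blast
  obtain C where C: "0 \<le> C" "eventually (\<lambda>k. iid.expectation (\<lambda>w. (spacing k w)\<^sup>2)
     \<le> C * (real k powr (2 * \<gamma> - 3) * ln (real k) powr (- 2 * \<delta>))) sequentially"
    using expectation_spacing_square_asymp_le by blast
  let ?r = "\<lambda>k. iid.expectation (\<lambda>w. (spacing k w)\<^sup>2) / (real k * (iid.expectation (spacing k))\<^sup>2)"
  have r_nonneg: "0 \<le> ?r k" for k
    by (simp add: integral_nonneg_AE)
  have "eventually (\<lambda>k. ?r k \<le> C / c\<^sup>2) sequentially"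
    using c(2) C(2) eventually_ge_at_top [of "2 :: nat"]
  proof eventually_elim
    case (elim k)
    define m where "m = real k powr (\<gamma> - 2) * ln (real k) powr (- \<delta>)"
    have "real k * m\<^sup>2 = real k powr (1 + 2 * (\<gamma> - 2)) * ln (real k) powr (2 * (- \<delta>))"
    proof -
      have "m\<^sup>2 = real k powr (2 * (\<gamma> - 2)) * ln (real k) powr (2 * (- \<delta>))"
        unfolding m_def power_mult_distrib powr_power [of _ _ 2] using elim(3)
        by (subst powr_power, simp)+ (simp only: mult.commute of_nat_numeral)
      then show ?thesis
        using elim(3) by (simp only: powr_add) simp
    qed
    then have *: "real k * m\<^sup>2 = real k powr (2 * \<gamma> - 3) * ln (real k) powr (- 2 * \<delta>)"
      by (simp add: algebra_simps)
    have "c\<^sup>2 * m\<^sup>2 \<le> (iid.expectation (spacing k))\<^sup>2"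
      using elim(1) c(1) power_mono [of "c * m" "iid.expectation (spacing k)" 2]
      by (simp add: m_def power_mult_distrib)
    then have "C * (real k * m\<^sup>2) \<le> C / c\<^sup>2 * (real k * (iid.expectation (spacing k))\<^sup>2)"
      using c(1) C(1) elim(3) by (simp add: field_simps mult_left_mono)
    with elim(2) * have "iid.expectation (\<lambda>w. (spacing k w)\<^sup>2)
        \<le> C / c\<^sup>2 * (real k * (iid.expectation (spacing k))\<^sup>2)"
      by simp
    then show ?case
      using elim(3) expectation_spacing_pos [of k] by (simp add: divide_le_eq)
  qed
  then obtain N where N: "\<And>k. N \<le> k \<Longrightarrow> ?r k \<le> C / c\<^sup>2"
    by (auto simp: eventually_sequentially)
  \<comment> \<open>All ratios are nonnegative, so the sum dominates each early one. The term at
    index 0 is a division by zero, hence 0.\<close>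
  define B where "B = C / c\<^sup>2 + (\<Sum>k<N. ?r k)"
  have "?r k \<le> B" for k
  proof (cases "N \<le> k")
    case True
    then show ?thesis
      using N [of k] sum_nonneg [of "{..<N}" ?r] r_nonneg by (auto simp: B_def)
  next
    case False
    then have "?r k \<le> (\<Sum>k<N. ?r k)"
      using r_nonneg by (intro member_le_sum) auto
    then show ?thesis
      using C(1) by (auto simp: B_def intro: order_trans)
  qed
  then have "iid.expectation (\<lambda>w. (spacing k w)\<^sup>2) \<le> B * real k * (iid.expectation (spacing k))\<^sup>2"
    if "1 \<le> k" for k
    using that expectation_spacing_pos [OF that] by (simp add: divide_le_eq mult.assoc)
  then show ?thesis by blast
qed

end

section \<open>Best linear unbiased estimation\<close>

definition square_integrable :: "'a measure \<Rightarrow> ('a \<Rightarrow> real) \<Rightarrow> bool" where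
  "square_integrable N X \<longleftrightarrow> X \<in> borel_measurable N \<and> integrable N (\<lambda>w. (X w)\<^sup>2)"

lemma integrable_mult_square_integrable:
  assumes "square_integrable N X" "square_integrable N Y"
  shows "integrable N (\<lambda>w. X w * Y w)"
proof (rule Bochner_Integration.integrable_bound)
  show "integrable N (\<lambda>w. (X w)\<^sup>2 + (Y w)\<^sup>2)"
    using assms by (auto simp: square_integrable_def)
  show "(\<lambda>w. X w * Y w) \<in> borel_measurable N"
    using assms by (auto simp: square_integrable_def)
  have "\<bar>x * y\<bar> \<le> x\<^sup>2 + y\<^sup>2" for x y :: real
    using sum_squares_bound [of "\<bar>x\<bar>" "\<bar>y\<bar>"] abs_ge_zero [of "x * y"]
    by (simp only: abs_mult power2_abs)
  then show "AE w in N. norm (X w * Y w) \<le> norm ((X w)\<^sup>2 + (Y w)\<^sup>2)"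
    by simp
qed

lemma square_integrable_add_mult:
  assumes "square_integrable N X" "square_integrable N Y"
  shows "square_integrable N (\<lambda>w. X w + a * Y w)"
proof -
  have "(X w + a * Y w)\<^sup>2 = (X w)\<^sup>2 + 2 * a * (X w * Y w) + a\<^sup>2 * (Y w)\<^sup>2" for w
    by (simp add: power2_eq_square algebra_simps)
  moreover have "(\<lambda>w. X w + a * Y w) \<in> borel_measurable N"
    using assms by (auto simp: square_integrable_def)
  ultimately show ?thesis
    using assms integrable_mult_square_integrable [OF assms] by (simp add: square_integrable_def)
qed

lemma square_integrable_zero: "square_integrable N (\<lambda>_. 0)"
  by (simp add: square_integrable_def)

lemma square_integrable_sum:
  assumes "\<And>i. i \<in> I \<Longrightarrow> square_integrable N (X i)"
  shows "square_integrable N (\<lambda>w. \<Sum>i\<in>I. a i * X i w)"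
  using assms
proof (induction I rule: infinite_finite_induct)
  case (insert i I)
  then show ?case
    using square_integrable_add_mult [of N "\<lambda>w. \<Sum>i\<in>I. a i * X i w" "X i" "a i"]
    by (simp add: add.commute)
qed (simp_all add: square_integrable_zero)

section \<open>Bilinearity of the covariance\<close>

lemma variance_of_eq_covariance_of: "variance_of N X = covariance_of N X X"
  by (simp add: variance_of_def covariance_of_def power2_eq_square)

lemma variance_of_nonneg: "0 \<le> variance_of N X"
  by (simp add: variance_of_def integral_nonneg_AE)

lemma covariance_of_commute: "covariance_of N X Y = covariance_of N Y X"
  by (simp add: covariance_of_def mult.commute)

context prob_space
begin

lemma square_integrable_imp_integrable': "square_integrable M X \<Longrightarrow> integrable M X"
  using square_integrable_imp_integrable by (auto simp: square_integrable_def)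

lemma covariance_of_eq:
  assumes "square_integrable M X" "square_integrable M Y"
  shows "covariance_of M X Y = expectation (\<lambda>w. X w * Y w) - expectation X * expectation Y"
proof -
  note int = assms [THEN square_integrable_imp_integrable'] integrable_mult_square_integrable [OF assms]
  have "covariance_of M X Y = expectation (\<lambda>w. X w * Y w - expectation Y * X w - expectation X * Y w
      + expectation X * expectation Y)"
    by (simp add: covariance_of_def algebra_simps)
  also have "\<dots> = expectation (\<lambda>w. X w * Y w) - expectation X * expectation Y"
    using int by (simp add: prob_space)
  finally show ?thesis .
qed

lemma covariance_of_add_mult:
  assumes X: "square_integrable M X" and Y: "square_integrable M Y" and Z: "square_integrable M Z"
  shows "covariance_of M (\<lambda>w. X w + a * Y w) Z = covariance_of M X Z + a * covariance_of M Y Z"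
proof -
  note int = X [THEN square_integrable_imp_integrable'] Y [THEN square_integrable_imp_integrable']
    integrable_mult_square_integrable [OF X Z] integrable_mult_square_integrable [OF Y Z]
  have "expectation (\<lambda>w. (X w + a * Y w) * Z w)
      = expectation (\<lambda>w. X w * Z w) + a * expectation (\<lambda>w. Y w * Z w)"
    using int by (simp add: ring_distribs mult.assoc)
  then show ?thesis
    using int square_integrable_add_mult [OF X Y] X Y Z
    by (simp add: covariance_of_eq algebra_simps)
qed

lemma covariance_of_sum_left:
  assumes "\<And>i. i \<in> I \<Longrightarrow> square_integrable M (X i)" "square_integrable M Z"
  shows "covariance_of M (\<lambda>w. \<Sum>i\<in>I. a i * X i w) Z = (\<Sum>i\<in>I. a i * covariance_of M (X i) Z)"
  using assms
proof (induction I rule: infinite_finite_induct)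
  case (insert i I)
  then show ?case
    using covariance_of_add_mult [of "\<lambda>w. \<Sum>i\<in>I. a i * X i w" "X i" Z "a i"]
    by (simp add: square_integrable_sum add.commute)
qed (simp_all add: covariance_of_def)

lemma variance_of_add_mult:
  assumes X: "square_integrable M X" and Y: "square_integrable M Y"
  shows "variance_of M (\<lambda>w. X w + a * Y w)
    = variance_of M X + 2 * a * covariance_of M X Y + a\<^sup>2 * variance_of M Y"
proof -
  let ?S = "\<lambda>w. X w + a * Y w"
  have S: "square_integrable M ?S"
    using X Y by (rule square_integrable_add_mult)
  have "variance_of M ?S = covariance_of M X ?S + a * covariance_of M Y ?S"
    unfolding variance_of_eq_covariance_of using X Y S by (rule covariance_of_add_mult)
  also have "covariance_of M X ?S = variance_of M X + a * covariance_of M Y X"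
    unfolding variance_of_eq_covariance_of
    by (subst covariance_of_commute) (rule covariance_of_add_mult [OF X Y X])
  also have "covariance_of M Y ?S = covariance_of M X Y + a * variance_of M Y"
    unfolding variance_of_eq_covariance_of
    by (subst covariance_of_commute) (rule covariance_of_add_mult [OF X Y Y])
  finally show ?thesis
    using covariance_of_commute [of M Y X] by (simp add: power2_eq_square algebra_simps)
qed

text \<open>With zero variance of \<open>X\<close>, the variance of Y + a X is affine in
  \<open>a\<close>; a nonzero slope would make it negative for some \<open>a\<close>. The chosen
  \<open>a\<close> yields the value -1.\<close>

lemma covariance_of_eq_0_if_variance_of_eq_0:
  assumes X: "square_integrable M X" and Y: "square_integrable M Y" and "variance_of M X = 0"
  shows "covariance_of M Y X = 0"
proof (rule ccontr)
  assume *: "covariance_of M Y X \<noteq> 0"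
  define a where "a = - (variance_of M Y + 1) / (2 * covariance_of M Y X)"
  have "0 \<le> variance_of M (\<lambda>w. Y w + a * X w)"
    by (rule variance_of_nonneg)
  also have "\<dots> = variance_of M Y + 2 * a * covariance_of M Y X"
    using assms by (simp add: variance_of_add_mult)
  also have "\<dots> = - 1"
    using * by (simp add: a_def field_simps)
  finally show False by simp
qed

section \<open>Minimum variance by projection\<close>

text \<open>A Gram-Schmidt step: remove from \<open>g\<close> and from \<open>h n\<close> their
  parts along the earlier \<open>h i\<close>, then remove from the first residual its part along the
  second. The covariance matrix of the \<open>h i\<close> may be singular.\<close>

lemma ex_uncorrelated_residual:
  fixes n :: nat
  assumes "\<And>i. i < n \<Longrightarrow> square_integrable M (h i)" "square_integrable M g"
  shows "\<exists>c. \<forall>j<n. covariance_of M (\<lambda>w. g w + (\<Sum>i<n. c i * h i w)) (h j) = 0"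
  using assms
proof (induction n arbitrary: g)
  case 0
  then show ?case by simp
next
  case (Suc n)
  have h: "square_integrable M (h i)" if "i < Suc n" for i
    using that Suc.prems by blast
  obtain c where c: "\<And>j. j < n \<Longrightarrow> covariance_of M (\<lambda>w. g w + (\<Sum>i<n. c i * h i w)) (h j) = 0"
    using Suc.IH [of g] Suc.prems by auto
  obtain d where d: "\<And>j. j < n \<Longrightarrow> covariance_of M (\<lambda>w. h n w + (\<Sum>i<n. d i * h i w)) (h j) = 0"
    using Suc.IH [of "h n"] Suc.prems by auto
  define r where "r = (\<lambda>w. g w + (\<Sum>i<n. c i * h i w))"
  define s where "s = (\<lambda>w. h n w + (\<Sum>i<n. d i * h i w))"
  have sum: "square_integrable M (\<lambda>w. \<Sum>i<n. e i * h i w)" for e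
    using h by (intro square_integrable_sum) auto
  have r: "square_integrable M r" and s: "square_integrable M s"
    using square_integrable_add_mult [OF Suc.prems(2) sum, of 1] square_integrable_add_mult [OF h sum, of n 1]
    by (simp_all add: r_def s_def)
  \<comment> \<open>If \<open>s\<close> has zero variance, then \<open>a = 0\<close> by division by
    zero, and the required equation still holds because the covariance vanishes too.\<close>
  define a where "a = - covariance_of M r s / variance_of M s"
  have a: "covariance_of M r s + a * variance_of M s = 0"
    using covariance_of_eq_0_if_variance_of_eq_0 [OF s r] by (cases "variance_of M s = 0") (auto simp: a_def)
  define t where "t = (\<lambda>w. r w + a * s w)"
  have t: "square_integrable M t"
    using square_integrable_add_mult [OF r s] by (simp add: t_def)
  have t_h: "covariance_of M t (h j) = 0" if "j < n" for j
    using c [OF that] d [OF that] covariance_of_add_mult [OF r s h, of j a] that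
    by (simp add: t_def r_def s_def)
  have "covariance_of M t (h n) = 0"
  proof -
    have "covariance_of M t s = 0"
      using a covariance_of_add_mult [OF r s s] by (simp add: t_def variance_of_eq_covariance_of)
    moreover have "covariance_of M (\<lambda>w. \<Sum>i<n. d i * h i w) t = 0"
      using h t t_h by (subst covariance_of_sum_left) (auto simp: covariance_of_commute [of M _ t])
    moreover have "covariance_of M s t = covariance_of M (h n) t + covariance_of M (\<lambda>w. \<Sum>i<n. d i * h i w) t"
      using covariance_of_add_mult [OF h sum t, of n 1] by (simp add: s_def)
    ultimately show ?thesis
      by (simp add: covariance_of_commute [of M _ t])
  qed
  with t_h have "\<forall>j<Suc n. covariance_of M t (h j) = 0"
    by (simp add: less_Suc_eq)
  moreover have "t = (\<lambda>w. g w + (\<Sum>i<Suc n. (if i = n then a else c i + a * d i) * h i w))"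
    by (simp add: t_def r_def s_def fun_eq_iff ring_distribs sum.distrib sum_distrib_left mult.assoc)
  ultimately show ?case
    by (intro exI [of _ "\<lambda>i. if i = n then a else c i + a * d i"]) simp
qed

text \<open>Pythagoras: the residual is uncorrelated with every \<open>h i\<close>, so changing the
  coefficients adds the variance of the change.\<close>

lemma ex_min_variance_combination:
  fixes n :: nat
  assumes h: "\<And>i. i < n \<Longrightarrow> square_integrable M (h i)" and g: "square_integrable M g"
  shows "\<exists>c. \<forall>d. variance_of M (\<lambda>w. g w + (\<Sum>i<n. c i * h i w))
    \<le> variance_of M (\<lambda>w. g w + (\<Sum>i<n. d i * h i w))"
proof -
  obtain c where c: "\<And>j. j < n \<Longrightarrow> covariance_of M (\<lambda>w. g w + (\<Sum>i<n. c i * h i w)) (h j) = 0"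
    using ex_uncorrelated_residual [of n h g, OF assms] by blast
  define r where "r = (\<lambda>w. g w + (\<Sum>i<n. c i * h i w))"
  have sum: "square_integrable M (\<lambda>w. \<Sum>i<n. e i * h i w)" for e
    using h by (intro square_integrable_sum) auto
  have r: "square_integrable M r"
    using square_integrable_add_mult [OF g sum, of 1] by (simp add: r_def)
  have "variance_of M r \<le> variance_of M (\<lambda>w. g w + (\<Sum>i<n. d i * h i w))" for d
  proof -
    let ?v = "\<lambda>w. \<Sum>i<n. (d i - c i) * h i w"
    have "covariance_of M ?v r = 0"
      using h r c [folded r_def]
      by (subst covariance_of_sum_left) (auto simp: covariance_of_commute [of M _ r])
    then have "variance_of M (\<lambda>w. r w + 1 * ?v w) = variance_of M r + variance_of M ?v"
      using variance_of_add_mult [OF r sum, of 1] by (simp add: covariance_of_commute [of M r])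
    moreover have "(\<lambda>w. r w + 1 * ?v w) = (\<lambda>w. g w + (\<Sum>i<n. d i * h i w))"
      by (simp add: r_def fun_eq_iff ring_distribs sum_subtractf left_diff_distrib)
    ultimately show ?thesis
      using variance_of_nonneg [of M ?v] by simp
  qed
  then show ?thesis
    unfolding r_def by blast
qed

text \<open>In the bilinear expansion each off-diagonal term is a product of two nonnegative weights
  and a nonpositive covariance.\<close>

lemma variance_of_sum_le:
  assumes X: "\<And>i. i \<in> I \<Longrightarrow> square_integrable M (X i)"
    and a: "\<And>i. i \<in> I \<Longrightarrow> 0 \<le> a i" and "finite I"
    and neg: "\<And>i j. i \<in> I \<Longrightarrow> j \<in> I \<Longrightarrow> i \<noteq> j \<Longrightarrow> covariance_of M (X i) (X j) \<le> 0"
  shows "variance_of M (\<lambda>w. \<Sum>i\<in>I. a i * X i w) \<le> (\<Sum>i\<in>I. (a i)\<^sup>2 * variance_of M (X i))"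
proof -
  let ?S = "\<lambda>w. \<Sum>i\<in>I. a i * X i w"
  have S: "square_integrable M ?S"
    using X by (rule square_integrable_sum)
  have "covariance_of M (X i) ?S \<le> a i * variance_of M (X i)" if i: "i \<in> I" for i
  proof -
    have "covariance_of M (X i) ?S = (\<Sum>j\<in>I. a j * covariance_of M (X j) (X i))"
      using X i by (subst covariance_of_commute) (rule covariance_of_sum_left)
    also have "\<dots> \<le> (\<Sum>j\<in>I. if j = i then a i * variance_of M (X i) else 0)"
      using a neg i
      by (intro sum_mono) (auto simp: variance_of_eq_covariance_of intro: mult_nonneg_nonpos)
    finally show ?thesis
      using \<open>finite I\<close> i by simp
  qed
  then have "(\<Sum>i\<in>I. a i * covariance_of M (X i) ?S) \<le> (\<Sum>i\<in>I. (a i)\<^sup>2 * variance_of M (X i))"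
    using a by (intro sum_mono) (simp add: power2_eq_square mult.assoc mult_left_mono)
  then show ?thesis
    using covariance_of_sum_left [of I X ?S a, OF X S] by (simp add: variance_of_eq_covariance_of)
qed

lemma variance_of_le_expectation_square:
  assumes "square_integrable M X"
  shows "variance_of M X \<le> expectation (\<lambda>w. (X w)\<^sup>2)"
  using covariance_of_eq [OF assms assms]
  by (simp add: variance_of_eq_covariance_of power2_eq_square)

end

section \<open>Linear estimators as combinations of spacings\<close>

lemma pmax_affine:
  assumes "1 \<le> k" "0 \<le> t2"
  shows "pmax (\<lambda>i. t1 + t2 * w i) k = t1 + t2 * pmax w k"
  using assms(1)
proof (induction k rule: dec_induct)
  case base
  then show ?case by (simp only: pmax_1)
next
  case (step k)
  then show ?case
    using assms(2) by (simp add: pmax_Suc max_mult_distrib_left)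
qed

lemma lin_est_affine:
  assumes "0 \<le> t2"
  shows "lin_est c n t1 t2 = (\<lambda>w. t1 * (\<Sum>i=1..n. c i) + t2 * lin_est c n 0 1 w)"
  using assms pmax_affine [of _ 1 0] pmax_affine [of _ t2 t1]
  by (simp add: fun_eq_iff lin_est_def ring_distribs sum.distrib sum_distrib_left mult_ac)

text \<open>The index is shifted: weight \<open>e i\<close> belongs to spacing \<open>Suc i\<close>,
  so \<open>N\<close> weights correspond to a sample of size \<open>Suc N\<close>.\<close>

definition spacing_est :: "(nat \<Rightarrow> real) \<Rightarrow> nat \<Rightarrow> (nat \<Rightarrow> real) \<Rightarrow> real" where
  "spacing_est e N w = (\<Sum>i<N. e i * spacing (Suc i) w)"

text \<open>Summation by parts. The boundary term disappears when the coefficients sum to 0.\<close>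

lemma lin_est_eq_spacing_est:
  "lin_est c (Suc N) 0 1 w = spacing_est (\<lambda>i. - (\<Sum>j=1..Suc i. c j)) N w
    + (\<Sum>j=1..Suc N. c j) * pmax w (Suc N)"
proof (induction N)
  case 0
  then show ?case by (simp add: lin_est_def spacing_est_def)
next
  case (Suc N)
  have "lin_est c (Suc (Suc N)) 0 1 w = lin_est c (Suc N) 0 1 w + c (Suc (Suc N)) * pmax w (Suc (Suc N))"
    by (simp add: lin_est_def)
  with Suc.IH show ?case
    by (simp add: spacing_est_def spacing_def algebra_simps)
qed

lemma ex_coeffs_of_spacing_est:
  "\<exists>c. (\<Sum>j=1..Suc N. c j) = 0 \<and> (\<forall>w. lin_est c (Suc N) 0 1 w = spacing_est e N w)"
proof -
  \<comment> \<open>\<open>E i\<close> is the prescribed value of the partial sum of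
    \<open>c\<close> from 1 to \<open>Suc i\<close>, and \<open>c\<close> is its difference
    sequence. The value 0 at \<open>N\<close> makes the total sum vanish.\<close>
  define E where "E = (\<lambda>i. if i < N then - e i else 0)"
  define c where "c = (\<lambda>j. E (j - 1) - (if j \<le> 1 then 0 else E (j - 2)))"
  have sum: "(\<Sum>j=1..Suc i. c j) = E i" for i
    by (induction i) (simp_all add: c_def)
  have "spacing_est (\<lambda>i. - (\<Sum>j=1..Suc i. c j)) N w = spacing_est e N w" for w
    unfolding spacing_est_def sum by (intro sum.cong) (auto simp: E_def)
  then show ?thesis
    using lin_est_eq_spacing_est [of c N] sum [of N] by (intro exI [of _ c]) (simp add: E_def)
qed

context square_integrable_distribution
begin

lemma square_integrable_spacing: "square_integrable P (spacing (Suc i))"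
  using measurable_spacing [of "Suc i"] integrable_spacing_square [of "Suc i"]
  by (simp add: square_integrable_def)

lemma expectation_spacing_est:
  "iid.expectation (spacing_est e N) = (\<Sum>i<N. e i * iid.expectation (spacing (Suc i)))"
  unfolding spacing_est_def [abs_def]
  by (subst Bochner_Integration.integral_sum) (auto intro: integrable_spacing)

lemma square_integrable_lin_est: "square_integrable P (lin_est c n 0 1)"
proof -
  have "square_integrable P (\<lambda>w. \<Sum>i=1..n. c i * pmax w i)"
    by (rule square_integrable_sum)
       (simp add: square_integrable_def measurable_pmax integrable_pmax_square)
  then show ?thesis
    by (simp add: lin_est_def [abs_def])
qed

lemma integrable_lin_est: "integrable P (lin_est c n 0 1)"
  using square_integrable_lin_est by (rule iid.square_integrable_imp_integrable')

lemma expectation_lin_est: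
  "0 \<le> t2 \<Longrightarrow> iid.expectation (lin_est c n t1 t2)
    = t1 * (\<Sum>i=1..n. c i) + t2 * iid.expectation (lin_est c n 0 1)"
  using integrable_lin_est [of c n] by (subst lin_est_affine) (simp_all add: iid.prob_space)

text \<open>By the affine form of the mean, the locations 0 and 1 at scale 1 already force both
  conditions, and these suffice for all parameters.\<close>

lemma unbiased_scale_iff:
  "unbiased_scale D n c \<longleftrightarrow> (\<Sum>i=1..n. c i) = 0 \<and> iid.expectation (lin_est c n 0 1) = 1"
proof
  assume u: "unbiased_scale D n c"
  then have "iid.expectation (lin_est c n 0 1) = 1" "iid.expectation (lin_est c n 1 1) = 1"
    by (simp_all add: unbiased_scale_def)
  then show "(\<Sum>i=1..n. c i) = 0 \<and> iid.expectation (lin_est c n 0 1) = 1"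
    using expectation_lin_est [of 1 c n 1] by simp
next
  assume *: "(\<Sum>i=1..n. c i) = 0 \<and> iid.expectation (lin_est c n 0 1) = 1"
  have "integrable P (lin_est c n t1 t2)" if "0 < t2" for t1 t2
    using that integrable_lin_est [of c n] by (subst lin_est_affine) simp_all
  moreover have "iid.expectation (lin_est c n t1 t2) = t2" if "0 < t2" for t1 t2
    using that * expectation_lin_est [of t2 c n t1] by simp
  ultimately show "unbiased_scale D n c"
    unfolding unbiased_scale_def by blast
qed

text \<open>The coefficients sum to 0, so the location cancels and the estimator scales with
  \<open>t2\<close>. Hence optimality at location 0 and scale 1 carries over to all
  parameters.\<close>

lemma variance_of_lin_est:
  assumes "unbiased_scale D n c" "0 < t2"
  shows "variance_of P (lin_est c n t1 t2) = t2\<^sup>2 * variance_of P (lin_est c n 0 1)"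
proof -
  have "lin_est c n t1 t2 = (\<lambda>w. t2 * lin_est c n 0 1 w)"
    using assms by (subst lin_est_affine) (simp_all add: unbiased_scale_iff)
  moreover have "(t2 * x - t2 * y)\<^sup>2 = t2\<^sup>2 * (x - y)\<^sup>2" for x y :: real
    by (simp add: power_mult_distrib [symmetric] right_diff_distrib)
  ultimately show ?thesis
    by (simp add: variance_of_def)
qed

lemma unbiased_lin_est_eq_spacing_est:
  assumes "unbiased_scale D (Suc N) c"
  obtains e where "lin_est c (Suc N) 0 1 = spacing_est e N"
    "(\<Sum>i<N. e i * iid.expectation (spacing (Suc i))) = 1"
proof
  let ?e = "\<lambda>i. - (\<Sum>j=1..Suc i. c j)"
  show eq: "lin_est c (Suc N) 0 1 = spacing_est ?e N"
    using assms lin_est_eq_spacing_est [of c N] unfolding unbiased_scale_iff by (simp add: fun_eq_iff)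
  show "(\<Sum>i<N. ?e i * iid.expectation (spacing (Suc i))) = 1"
    using assms eq unfolding unbiased_scale_iff by (simp only: expectation_spacing_est)
qed

lemma spacing_est_eq_unbiased_lin_est:
  assumes "(\<Sum>i<N. e i * iid.expectation (spacing (Suc i))) = 1"
  obtains c where "unbiased_scale D (Suc N) c" "lin_est c (Suc N) 0 1 = spacing_est e N"
proof -
  obtain c where c: "(\<Sum>j=1..Suc N. c j) = 0" "\<forall>w. lin_est c (Suc N) 0 1 w = spacing_est e N w"
    using ex_coeffs_of_spacing_est by blast
  then have "lin_est c (Suc N) 0 1 = spacing_est e N"
    by (simp add: fun_eq_iff)
  moreover from this have "unbiased_scale D (Suc N) c"
    using c(1) assms unfolding unbiased_scale_iff by (simp only: expectation_spacing_est)
  ultimately show ?thesis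
    using that by blast
qed

section \<open>Existence, variance and deviations of the BLUE\<close>

text \<open>The linear constraint of unbiasedness is eliminated through the first spacing:
  \<open>g\<close> is that spacing scaled to mean 1, and each \<open>h i\<close> is a spacing
  centred by a multiple of it. What remains is an unconstrained minimisation. A sample of size at
  least 2 is what provides a spacing.\<close>

lemma ex_BLUE_scale:
  assumes pos: "0 < iid.expectation (spacing 1)" and n: "2 \<le> n"
  shows "\<exists>c. is_BLUE_scale D n c"
proof -
  obtain N where N: "n = Suc N" "0 < N"
    using n by (cases n) auto
  define m where "m = (\<lambda>i. iid.expectation (spacing (Suc i)))"
  have m0: "0 < m 0"
    using pos by (simp add: m_def)
  define g where "g = (\<lambda>w. 1 / m 0 * spacing 1 w)"
  define h where "h = (\<lambda>i w. spacing (Suc i) w + - (m i / m 0) * spacing 1 w)"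
  have g: "square_integrable P g"
    using square_integrable_add_mult [OF square_integrable_zero square_integrable_spacing [of 0], of "1 / m 0"]
    by (simp add: g_def)
  have h: "square_integrable P (h i)" for i
    unfolding h_def
    using square_integrable_add_mult [OF square_integrable_spacing [of i] square_integrable_spacing [of 0]]
    by (simp only: One_nat_def)
  have rep: "spacing_est e N = (\<lambda>w. g w + (\<Sum>i<N. e i * h i w))" if "(\<Sum>i<N. e i * m i) = 1" for e
  proof
    fix w
    have "(\<Sum>i<N. e i * h i w) = spacing_est e N w - (\<Sum>i<N. e i * m i) / m 0 * spacing 1 w"
      by (simp add: h_def spacing_est_def ring_distribs sum_subtractf sum_distrib_right
          sum_divide_distrib mult.assoc)
    then show "spacing_est e N w = g w + (\<Sum>i<N. e i * h i w)"
      using that by (simp add: g_def)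
  qed
  obtain a where a: "\<And>d. variance_of P (\<lambda>w. g w + (\<Sum>i<N. a i * h i w))
      \<le> variance_of P (\<lambda>w. g w + (\<Sum>i<N. d i * h i w))"
    using iid.ex_min_variance_combination [of N h g] g h by blast
  \<comment> \<open>Since \<open>h 0\<close> is identically 0, the weight at index 0 does not affect
    the combination and can be reset to meet the constraint.\<close>
  define e where "e = a(0 := a 0 + (1 - (\<Sum>i<N. a i * m i)) / m 0)"
  have split: "(\<Sum>i<N. x i) = x 0 + (\<Sum>i\<in>{..<N} - {0}. x i)" for x :: "nat \<Rightarrow> real"
    using N by (subst sum.remove [of _ 0]) auto
  have e_m: "(\<Sum>i<N. e i * m i) = 1"
  proof -
    have "(\<Sum>i\<in>{..<N} - {0}. e i * m i) = (\<Sum>i\<in>{..<N} - {0}. a i * m i)"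
      by (intro sum.cong) (auto simp: e_def)
    moreover have "e 0 * m 0 = a 0 * m 0 + (1 - (\<Sum>i<N. a i * m i))"
      using m0 by (simp add: e_def field_simps)
    ultimately show ?thesis
      using split [of "\<lambda>i. e i * m i"] split [of "\<lambda>i. a i * m i"] by linarith
  qed
  have e_h: "spacing_est e N = (\<lambda>w. g w + (\<Sum>i<N. a i * h i w))"
  proof -
    have "h 0 w = 0" for w
      using m0 by (simp add: h_def)
    then have "(\<Sum>i<N. e i * h i w) = (\<Sum>i<N. a i * h i w)" for w
      by (intro sum.cong) (auto simp: e_def)
    then show ?thesis
      using rep [OF e_m] by simp
  qed
  obtain c where c: "unbiased_scale D n c"
      "lin_est c n 0 1 = (\<lambda>w. g w + (\<Sum>i<N. a i * h i w))"
    using spacing_est_eq_unbiased_lin_est [OF e_m [unfolded m_def]] unfolding N e_h by blast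
  have "variance_of P (lin_est c n t1 t2) \<le> variance_of P (lin_est d n t1 t2)"
    if d: "unbiased_scale D n d" and "0 < t2" for d t1 t2
  proof -
    obtain b where "lin_est d n 0 1 = spacing_est b N" "(\<Sum>i<N. b i * m i) = 1"
      using unbiased_lin_est_eq_spacing_est [OF d [unfolded N]] unfolding N m_def by blast
    then have "variance_of P (lin_est c n 0 1) \<le> variance_of P (lin_est d n 0 1)"
      using a c(2) rep by simp
    then show ?thesis
      using variance_of_lin_est [OF d \<open>0 < t2\<close>] variance_of_lin_est [OF c(1) \<open>0 < t2\<close>]
      by (simp add: mult_left_mono)
  qed
  then show ?thesis
    using c(1) unfolding is_BLUE_scale_def by blast
qed

text \<open>The BLUE is compared with one explicit unbiased estimator, whose variance is at most
  \<open>C / H\<close>; the harmonic number \<open>H\<close> is at least ln (N + 1) = ln n.\<close>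

lemma BLUE_variance_le:
  assumes ncp: "NCP D" and blue: "is_BLUE_scale D n c" and n: "2 \<le> n" and t2: "0 < t2"
    and pos: "\<And>k. 1 \<le> k \<Longrightarrow> 0 < iid.expectation (spacing k)"
    and ratio: "\<And>k. 1 \<le> k \<Longrightarrow> iid.expectation (\<lambda>w. (spacing k w)\<^sup>2)
      \<le> C * real k * (iid.expectation (spacing k))\<^sup>2"
  shows "variance_of P (lin_est c n t1 t2) \<le> t2\<^sup>2 * C / ln (real n)"
proof -
  obtain N where N: "n = Suc N" "0 < N"
    using n by (cases n) auto
  define m where "m = (\<lambda>i. iid.expectation (spacing (Suc i)))"
  have m: "0 < m i" for i
    using pos by (simp add: m_def)
  define H :: real where "H = harm N"
  have H: "0 < H" "ln (real n) \<le> H"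
    using N ln_le_harm [of N] by (auto simp: H_def harm_pos add.commute)
  have H_eq: "H = (\<Sum>i<N. 1 / real (Suc i))"
    by (simp add: H_def harm_def inverse_eq_divide sum.atLeast1_atMost_eq)
  \<comment> \<open>Read off from the moment inequality at \<open>k = 1\<close>, where the mean is
    positive; it allows \<open>H\<close> to be replaced by the logarithm.\<close>
  have C: "0 \<le> C"
  proof -
    have "0 \<le> C * (1 * (iid.expectation (spacing 1))\<^sup>2)"
      using ratio [of 1] by (intro order_trans [OF _ ratio [of 1, simplified mult.assoc of_nat_1]]) (auto simp: integral_nonneg_AE)
    then show ?thesis
      using pos [of 1] by (simp add: zero_le_mult_iff)
  qed
  text \<open>Weights proportional to \<open>1 / (i * E Z\<^sub>i)\<close>: they minimise the bound on the variance that is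
    obtained by dropping the nonpositive covariances and replacing \<open>E Z\<^sub>i\<^sup>2\<close> by \<open>C * i * (E Z\<^sub>i)\<^sup>2\<close>.\<close>
  define e where "e = (\<lambda>i. 1 / (real (Suc i) * m i * H))"
  have e_m: "e i * m i = 1 / real (Suc i) / H" for i
    using m [of i] by (simp add: e_def)
  have e_sum: "(\<Sum>i<N. e i * m i) = 1"
    unfolding e_m sum_divide_distrib [symmetric] using H H_eq by simp
  obtain d where d: "unbiased_scale D n d" "lin_est d n 0 1 = spacing_est e N"
    using spacing_est_eq_unbiased_lin_est [OF e_sum [unfolded m_def]] unfolding N by blast
  have "variance_of P (spacing_est e N) \<le> (\<Sum>i<N. (e i)\<^sup>2 * variance_of P (spacing (Suc i)))"
    unfolding spacing_est_def [abs_def]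
  proof (rule iid.variance_of_sum_le)
    show "0 \<le> e i" for i
      using m [of i] H by (simp add: e_def)
    show "covariance_of P (spacing (Suc i)) (spacing (Suc j)) \<le> 0" if "i \<noteq> j" for i j
      using ncp that by (simp add: NCP_def)
  qed (auto intro: square_integrable_spacing)
  also have "\<dots> \<le> (\<Sum>i<N. C / H\<^sup>2 * (1 / real (Suc i)))"
  proof (rule sum_mono)
    fix i
    have "variance_of P (spacing (Suc i)) \<le> C * real (Suc i) * (m i)\<^sup>2"
      using iid.variance_of_le_expectation_square [OF square_integrable_spacing] ratio [of "Suc i"]
      by (auto simp: m_def intro: order_trans)
    then have "(e i)\<^sup>2 * variance_of P (spacing (Suc i)) \<le> (e i)\<^sup>2 * (C * real (Suc i) * (m i)\<^sup>2)"
      by (intro mult_left_mono) auto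
    also have "\<dots> = C * real (Suc i) * (e i * m i)\<^sup>2"
      by (simp add: power_mult_distrib)
    also have "\<dots> = C / H\<^sup>2 * (1 / real (Suc i))"
      unfolding e_m by (simp add: power_divide power2_eq_square)
    finally show "(e i)\<^sup>2 * variance_of P (spacing (Suc i)) \<le> C / H\<^sup>2 * (1 / real (Suc i))" .
  qed
  also have "\<dots> = C / H"
    unfolding sum_distrib_left [symmetric] H_eq [symmetric] by (simp add: power2_eq_square)
  also have "\<dots> \<le> C / ln (real n)"
    using H C n by (intro divide_left_mono mult_pos_pos) auto
  finally have "variance_of P (lin_est d n 0 1) \<le> C / ln (real n)"
    using d by simp
  moreover have "variance_of P (lin_est c n t1 t2) \<le> t2\<^sup>2 * variance_of P (lin_est d n 0 1)"
    using blue d(1) t2 unfolding is_BLUE_scale_def variance_of_lin_est [OF d(1) t2, of t1, symmetric]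
    by blast
  moreover have "t2\<^sup>2 * variance_of P (lin_est d n 0 1) \<le> t2\<^sup>2 * (C / ln (real n))"
    using calculation(1) by (rule mult_left_mono) simp
  ultimately show ?thesis
    by simp
qed

lemma measure_deviation_le:
  assumes "unbiased_scale D n c" "0 < t2" "0 < \<epsilon>"
  shows "measure P {w \<in> space P. \<bar>lin_est c n t1 t2 w - t2\<bar> > \<epsilon>}
    \<le> variance_of P (lin_est c n t1 t2) / \<epsilon>\<^sup>2"
proof -
  have int: "integrable P (lin_est c n t1 t2)" and mean: "iid.expectation (lin_est c n t1 t2) = t2"
    using assms by (auto simp: unbiased_scale_def)
  note [measurable] = borel_measurable_integrable [OF int]
  have "lin_est c n t1 t2 = (\<lambda>w. 0 + t2 * lin_est c n 0 1 w)"
    using assms by (subst lin_est_affine) (simp_all add: unbiased_scale_iff)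
  then have "square_integrable P (lin_est c n t1 t2)"
    by (simp only: square_integrable_add_mult square_integrable_zero square_integrable_lin_est)
  then have "integrable P (\<lambda>w. (lin_est c n t1 t2 w)\<^sup>2)"
    by (simp add: square_integrable_def)
  from iid.Chebyshev_inequality [OF _ this \<open>0 < \<epsilon>\<close>]
  have "measure P {w \<in> space P. \<epsilon> \<le> \<bar>lin_est c n t1 t2 w - t2\<bar>} \<le> variance_of P (lin_est c n t1 t2) / \<epsilon>\<^sup>2"
    using mean by (simp add: variance_of_def)
  moreover have "measure P {w \<in> space P. \<bar>lin_est c n t1 t2 w - t2\<bar> > \<epsilon>}
      \<le> measure P {w \<in> space P. \<epsilon> \<le> \<bar>lin_est c n t1 t2 w - t2\<bar>}"
    by (intro iid.finite_measure_mono) auto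
  ultimately show ?thesis by simp
qed

end

section \<open>Regularity at the right endpoint\<close>

lemma eventually_to_omegaD:
  assumes "ereal M < omega F" "eventually Q (to_omega F)"
  obtains M' where "M \<le> M'" "ereal M' < omega F" "\<And>x. M' < x \<Longrightarrow> ereal x < omega F \<Longrightarrow> Q x"
proof (cases "omega F")
  case (real r)
  then have "eventually Q (at_left r)"
    using assms(2) by (simp add: to_omega_def)
  then obtain b where "b < r" "\<And>y. b < y \<Longrightarrow> y < r \<Longrightarrow> Q y"
    by (auto simp: eventually_at_left_field)
  then show ?thesis
    using assms(1) real by (intro that [of "max M b"]) auto
next
  case PInf
  then have "eventually Q at_top"
    using assms(2) by (simp add: to_omega_def)
  then obtain b where "\<And>y. b \<le> y \<Longrightarrow> Q y"
    by (auto simp: eventually_at_top_linorder)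
  then show ?thesis
    using PInf by (intro that [of "max M b"]) (auto simp: max_def split: if_splits)
next
  case MInf
  then show ?thesis
    using assms(1) by simp
qed

text \<open>At the endpoint itself, monotonicity bounds the value below by the left limit 1;
  strictly beyond it, the infimum supplies an earlier point of value 1.\<close>

lemma (in real_distribution) cdf_eq_1_if_omega_le:
  assumes "omega (cdf M) \<le> ereal x" "(cdf M \<longlongrightarrow> 1) (to_omega (cdf M))"
  shows "cdf M x = 1"
proof (rule antisym)
  show "1 \<le> cdf M x"
  proof (cases "omega (cdf M) = ereal x")
    case True
    then have "(cdf M \<longlongrightarrow> 1) (at_left x)"
      using assms(2) by (simp add: to_omega_def)
    moreover have "eventually (\<lambda>y. cdf M y \<le> cdf M x) (at_left x)"
      by (auto simp: eventually_at_filter cdf_nondecreasing)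
    ultimately show ?thesis
      by (rule tendsto_upperbound) simp
  next
    case False
    then have "omega (cdf M) < ereal x"
      using assms(1) by simp
    then obtain y where "cdf M y = 1" "y < x"
      by (auto simp: omega_def Inf_less_iff)
    then show ?thesis
      using cdf_nondecreasing [of y x] by simp
  qed
qed (rule cdf_bounded_prob)

lemma (in real_distribution) cdf_less_1_if_less_omega:
  assumes "ereal x < omega (cdf M)"
  shows "cdf M x < 1"
proof -
  have "cdf M x \<noteq> 1"
    using assms Inf_lower [of "ereal x" "ereal ` {x. cdf M x = 1}"] by (auto simp: omega_def)
  then show ?thesis
    using cdf_bounded_prob [of x] by simp
qed

text \<open>A positive liminf and a finite limsup give constants valid close to the endpoint, and
  the neighbourhood is shrunk until all conditions hold at once. Quantiles exist by the intermediate
  value theorem, as differentiability gives continuity.\<close>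

lemma (in square_integrable_distribution) ex_regular_tail:
  assumes lim: "(cdf D \<longlongrightarrow> 1) (to_omega (cdf D))" and M: "ereal M < omega (cdf D)"
    and der: "\<And>x. M < x \<Longrightarrow> ereal x < omega (cdf D) \<Longrightarrow> (cdf D has_real_derivative f x) (at x)"
    and \<gamma>: "\<gamma> < 3 / 2" and \<delta>: "0 \<le> \<delta>"
    and lower: "0 < L_lower (cdf D) f \<delta> \<gamma>" and upper: "L_upper (cdf D) f \<delta> \<gamma> < \<infinity>"
  obtains M' a b p\<^sub>0 where "regular_tail D f M' a b \<gamma> \<delta> p\<^sub>0 (omega (cdf D))"
proof -
  define \<omega> where "\<omega> = omega (cdf D)"
  let ?L = "Lfun (cdf D) f \<delta> \<gamma>"
  obtain a where a: "0 < a" "eventually (\<lambda>x. a < ?L x) (to_omega (cdf D))"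
  proof -
    obtain a where "0 < ereal a" "ereal a < L_lower (cdf D) f \<delta> \<gamma>"
      using ereal_dense2 [OF lower] by auto
    then show ?thesis
      using less_LiminfD [of "ereal a" "to_omega (cdf D)" "\<lambda>x. ereal (?L x)"]
      by (intro that) (auto simp: L_lower_def)
  qed
  obtain b where b: "eventually (\<lambda>x. ?L x < b) (to_omega (cdf D))"
  proof -
    obtain b where "L_upper (cdf D) f \<delta> \<gamma> < ereal b"
      using ereal_dense2 [OF upper] by auto
    then show ?thesis
      using Limsup_lessD [of "to_omega (cdf D)" "\<lambda>x. ereal (?L x)" "ereal b"]
      by (intro that) (auto simp: L_upper_def)
  qed
  \<comment> \<open>This threshold is what makes the logarithmic factor at least 1.\<close>
  have "eventually (\<lambda>x. 1 - exp (- 1) < cdf D x) (to_omega (cdf D))"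
    using lim by (rule order_tendstoD) simp
  with a(2) b have "eventually (\<lambda>x. a < ?L x \<and> ?L x < b \<and> 1 - exp (- 1) < cdf D x) (to_omega (cdf D))"
    by eventually_elim simp
  then obtain M' where M': "M \<le> M'" "ereal M' < \<omega>"
    and near: "\<And>x. M' < x \<Longrightarrow> ereal x < \<omega> \<Longrightarrow> a < ?L x \<and> ?L x < b \<and> 1 - exp (- 1) < cdf D x"
    using eventually_to_omegaD [OF M] unfolding \<omega>_def by blast
  obtain x\<^sub>0 where x0: "M' < x\<^sub>0" "ereal x\<^sub>0 < \<omega>"
    using ereal_dense2 [OF M'(2)] by auto
  have less_1: "cdf D x < 1" if "ereal x < \<omega>" for x
    using that cdf_less_1_if_less_omega by (simp add: \<omega>_def)
  have log_ge: "1 \<le> - ln (1 - cdf D x)" if "M' < x" "ereal x < \<omega>" for x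
  proof -
    have "ln (1 - cdf D x) \<le> ln (exp (- 1))"
      using near [OF that] less_1 [OF that(2)] by (subst ln_le_cancel_iff) auto
    then show ?thesis by simp
  qed
  have den: "0 < (1 - cdf D x) powr \<gamma> * (- ln (1 - cdf D x)) powr \<delta>" if "M' < x" "ereal x < \<omega>" for x
    using log_ge [OF that] less_1 [OF that(2)] by (intro mult_pos_pos) auto
  \<comment> \<open>The maximum with 1 makes the upper constant visibly positive. The level of
    \<open>x\<^sub>0\<close> is where the intermediate value argument starts.\<close>
  have "regular_tail D f M' a (max 1 b) \<gamma> \<delta> (cdf D x\<^sub>0) \<omega>"
  proof
    fix x assume x: "M' < x" "ereal x < \<omega>"
    show "(cdf D has_real_derivative f x) (at x)"
      using der x M'(1) by (simp add: \<omega>_def)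
    show "cdf D x < 1" "1 \<le> - ln (1 - cdf D x)"
      using less_1 log_ge x by auto
    show "a * ((1 - cdf D x) powr \<gamma> * (- ln (1 - cdf D x)) powr \<delta>) \<le> f x"
      using near [OF x] den [OF x] by (simp add: Lfun_def less_divide_eq)
    have "f x \<le> b * ((1 - cdf D x) powr \<gamma> * (- ln (1 - cdf D x)) powr \<delta>)"
      using near [OF x] den [OF x] by (simp add: Lfun_def divide_less_eq)
    also have "\<dots> \<le> max 1 b * ((1 - cdf D x) powr \<gamma> * (- ln (1 - cdf D x)) powr \<delta>)"
      using den [OF x] by (intro mult_right_mono) auto
    finally show "f x \<le> max 1 b * ((1 - cdf D x) powr \<gamma> * (- ln (1 - cdf D x)) powr \<delta>)" .
  next
    fix p assume p: "cdf D x\<^sub>0 \<le> p" "p < 1"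
    have "eventually (\<lambda>x. p < cdf D x) (to_omega (cdf D))"
      using lim p(2) by (rule order_tendstoD)
    then obtain M'' where M'': "x\<^sub>0 \<le> M''" "ereal M'' < \<omega>"
      "\<And>x. M'' < x \<Longrightarrow> ereal x < \<omega> \<Longrightarrow> p < cdf D x"
      using eventually_to_omegaD [of x\<^sub>0 "cdf D"] x0 unfolding \<omega>_def by blast
    obtain x\<^sub>1 where x1: "M'' < x\<^sub>1" "ereal x\<^sub>1 < \<omega>"
      using ereal_dense2 [OF M''(2)] by auto
    have sub: "ereal x < \<omega>" if "x \<le> x\<^sub>1" for x
      using that x1(2) by (meson ereal_less_eq(3) order.strict_trans1)
    have "isCont (cdf D) x" if "x\<^sub>0 \<le> x" "x \<le> x\<^sub>1" for x
      using der [of x] that x0 M'(1) sub [of x] by (auto intro: DERIV_isCont simp: \<omega>_def)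
    then have "continuous_on {x\<^sub>0..x\<^sub>1} (cdf D)"
      by (intro continuous_at_imp_continuous_on) auto
    then obtain x where "x\<^sub>0 \<le> x" "x \<le> x\<^sub>1" "cdf D x = p"
      using IVT' [of "cdf D" x\<^sub>0 p x\<^sub>1] p M''(1) M''(3) [OF x1] x1 by auto
    then show "\<exists>x. M' < x \<and> ereal x < \<omega> \<and> cdf D x = p"
      using x0 sub by (intro exI [of _ x]) auto
  qed (use a \<gamma> \<delta> x0 less_1 lim cdf_eq_1_if_omega_le in \<open>auto simp: \<omega>_def\<close>)
  then show ?thesis
    using that by (simp add: \<omega>_def)
qed

section \<open>Consistency of the BLUE and the logarithmic variance rate\<close>

theorem theorem5p2:
  fixes D :: "real measure" and F f :: "real \<Rightarrow> real" and M :: real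
  assumes "real_distribution D"
    and "cdf D = F"
    and "integrable D (\<lambda>x. x\<^sup>2)"
    and "nondegenerate F"
    and "NCP D"
    and "(F \<longlongrightarrow> 1) (to_omega F)"
    and "ereal M < omega F"
    and "\<forall>x. M < x \<and> ereal x < omega F \<longrightarrow> (F has_real_derivative f x) (at x)"
    and "(\<exists>\<gamma> < 3/2. 0 < L_lower F f 0 \<gamma> \<and> L_lower F f 0 \<gamma> \<le> L_upper F f 0 \<gamma>
                      \<and> L_upper F f 0 \<gamma> < \<infinity>)
       \<or> (\<exists>\<delta> > 0. \<exists>\<gamma>. 1/2 < \<gamma> \<and> \<gamma> \<le> 1 \<and>
             0 < L_lower F f \<delta> \<gamma> \<and> L_lower F f \<delta> \<gamma> \<le> L_upper F f \<delta> \<gamma>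
             \<and> L_upper F f \<delta> \<gamma> < \<infinity>)"
  shows "(\<exists>c. \<forall>n\<ge>2. is_BLUE_scale D n (c n)) \<and>
    (\<forall>c. (\<forall>n\<ge>2. is_BLUE_scale D n (c n)) \<longrightarrow>
      (\<forall>t1 t2. t2 > 0 \<longrightarrow>
         (\<forall>\<epsilon>>0. (\<lambda>n. measure (iid_model D)
                 {w \<in> space (iid_model D). \<bar>lin_est (c n) n t1 t2 w - t2\<bar> > \<epsilon>})
                \<longlonglongrightarrow> 0) \<and>
         (\<lambda>n. variance_of (iid_model D) (lin_est (c n) n t1 t2)) \<in> O(\<lambda>n. 1 / ln (real n))))"
proof -
  interpret square_integrable_distribution D
    using assms(1,3) by (simp add: square_integrable_distribution_def square_integrable_distribution_axioms_def)
  \<comment> \<open>Both alternatives take this form: the first with \<delta> = 0, the second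
    because \<gamma> \<le> 1 < 3/2.\<close>
  obtain \<gamma> \<delta> where "\<gamma> < 3 / 2" "0 \<le> \<delta>" "0 < L_lower F f \<delta> \<gamma>" "L_upper F f \<delta> \<gamma> < \<infinity>"
    using assms(9)
  proof (elim disjE exE conjE)
    fix \<gamma> assume "\<gamma> < 3/2" "0 < L_lower F f 0 \<gamma>" "L_upper F f 0 \<gamma> < \<infinity>"
    then show thesis by (intro that [of \<gamma> 0]) auto
  next
    fix \<delta> \<gamma> :: real
    assume "0 < \<delta>" "\<gamma> \<le> 1" "0 < L_lower F f \<delta> \<gamma>" "L_upper F f \<delta> \<gamma> < \<infinity>"
    then show thesis by (intro that [of \<gamma> \<delta>]) auto
  qed
  then obtain M' a b p\<^sub>0 where "regular_tail D f M' a b \<gamma> \<delta> p\<^sub>0 (omega (cdf D))"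
    using ex_regular_tail [of M f \<gamma> \<delta>] assms(2,6-8) by blast
  then interpret regular_tail D f M' a b \<gamma> \<delta> p\<^sub>0 "omega (cdf D)" .
  obtain C where ratio: "\<And>k. 1 \<le> k \<Longrightarrow> iid.expectation (\<lambda>w. (spacing k w)\<^sup>2)
      \<le> C * real k * (iid.expectation (spacing k))\<^sup>2"
    using spacing_moment_ratio by blast
  have "\<exists>c. \<forall>n\<ge>2. is_BLUE_scale D n (c n)"
    using ex_BLUE_scale [OF expectation_spacing_pos] by (intro choice) auto
  moreover have "(\<forall>\<epsilon>>0. (\<lambda>n. measure P {w \<in> space P. \<bar>lin_est (c n) n t1 t2 w - t2\<bar> > \<epsilon>}) \<longlonglongrightarrow> 0)
      \<and> (\<lambda>n. variance_of P (lin_est (c n) n t1 t2)) \<in> O(\<lambda>n. 1 / ln (real n))"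
    if c: "\<forall>n\<ge>2. is_BLUE_scale D n (c n)" and t2: "0 < t2" for c t1 t2
  proof (intro conjI allI impI)
    have bound: "eventually (\<lambda>n. variance_of P (lin_est (c n) n t1 t2) \<le> t2\<^sup>2 * C / ln (real n)) sequentially"
      using BLUE_variance_le [OF assms(5) _ _ t2 expectation_spacing_pos ratio] c
      by (intro eventually_sequentiallyI [of 2]) auto
    show "(\<lambda>n. variance_of P (lin_est (c n) n t1 t2)) \<in> O(\<lambda>n. 1 / ln (real n))"
    proof (rule bigoI)
      show "eventually (\<lambda>n. norm (variance_of P (lin_est (c n) n t1 t2))
          \<le> t2\<^sup>2 * C * norm (1 / ln (real n))) sequentially"
        using bound eventually_ge_at_top [of "2 :: nat"]
        by eventually_elim (simp add: variance_of_nonneg)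
    qed
    fix \<epsilon> :: real assume "0 < \<epsilon>"
    show "(\<lambda>n. measure P {w \<in> space P. \<bar>lin_est (c n) n t1 t2 w - t2\<bar> > \<epsilon>}) \<longlonglongrightarrow> 0"
    \<comment> \<open>Chebyshev bounds the deviation probability by the variance over \<epsilon>
      squared, which tends to 0 like 1 / ln n.\<close>
    proof (rule tendsto_sandwich [of "\<lambda>_. 0"])
      show "eventually (\<lambda>n. measure P {w \<in> space P. \<bar>lin_est (c n) n t1 t2 w - t2\<bar> > \<epsilon>}
          \<le> t2\<^sup>2 * C / ln (real n) / \<epsilon>\<^sup>2) sequentially"
        using bound eventually_ge_at_top [of "2 :: nat"]
      proof eventually_elim
        case (elim n)
        then have "unbiased_scale D n (c n)"
          using c by (simp add: is_BLUE_scale_def)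
        from measure_deviation_le [OF this t2 \<open>0 < \<epsilon>\<close>, of t1] elim(1) show ?case
          by (rule order_trans [OF _ divide_right_mono]) simp
      qed
      show "(\<lambda>n. t2\<^sup>2 * C / ln (real n) / \<epsilon>\<^sup>2) \<longlonglongrightarrow> 0"
      proof -
        have "(\<lambda>n. 1 / ln (real n)) \<longlonglongrightarrow> 0"
          by real_asymp
        from tendsto_mult_right [OF this, of "t2\<^sup>2 * C / \<epsilon>\<^sup>2"] show ?thesis
          by (simp add: mult.commute)
      qed
    qed auto
  qed
  ultimately show ?thesis by blast
qed

end
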